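(* Let $X$ be a closed subset of $\mathbb{R}^d$, let $p_1,\dots,p_m\in\mathbb{R}[x_1,\dots,x_d]$, let $T$ be a closed subset of $\mathbb{R}^m$ with $p(X)\subseteq T$, where $p:X\to T$, $p(x)=(p_1(x),\dots,p_m(x))$. Let $\nu\in\mathcal{M}(X)$, let $\mu=p(\nu)$ be the image measure of $\nu$ under $p$, and let $t\mapsto\lambda_t$ be a disintegration of $\nu$ with respect to $p$. If $\mu$ is strictly determinate on $T$ and $\lambda_t$ is determinate on the fibre $p^{-1}(t)$ for $\mu$-almost all $t\in T$, then $\nu$ is determinate on $X$.
   Context: $\mathcal{M}(\mathbb{R}^d)$ is the set of positive Borel measures on $\mathbb{R}^d$ having all moments finite; for closed $K\subseteq\mathbb{R}^d$, $\mathcal{M}(K)$ is the set of those with support in $K$. A measure $\sigma\in\mathcal{M}(K)$ is determinate on $K$ if every $\sigma'\in\mathcal{M}(K)$ with the same moments equals $\sigma$. A measure $\mu\in\mathcal{M}(T)$, $T\subseteq\mathbb{R}^m$ closed, is strictly determinate on $T$ if it is determinate on $T$ and $\mathbb{C}[t_1,\dots,t_m]$ is dense in $L^2(\mu)$. The fibre is $p^{-1}(t)=\{x\in X:p(x)=t\}$. Disintegration: a mapping $t\mapsto\lambda_t$ of $T$ into the positive Borel measures on $X$ such that (i) $\operatorname{supp}\lambda_t\subseteq p^{-1}(t)$; (ii) $\lambda_t(p^{-1}(t))=1$ for $\mu$-almost all $t$; (iii) $\int_Xf(x)\,d\nu(x)=\int_Td\mu(t)\int_Xf(x)\,d\lambda_t(x)$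 for all $\nu$-integrable $f$. Such a disintegration always exists, and in the present setting $\mu\in\mathcal{M}(T)$ and $\lambda_t\in\mathcal{M}(X)$ for $\mu$-almost all $t$. *)

theory Defs
  imports "HOL-Probability.Probability"
begin

definition measure_support :: "'a::topological_space measure \<Rightarrow> 'a set" where
  "measure_support M = {x. \<forall>U. open U \<and> x \<in> U \<longrightarrow> emeasure M U > 0}"

definition monomial :: "('n::finite \<Rightarrow> nat) \<Rightarrow> real ^ 'n \<Rightarrow> real" where
  "monomial \<alpha> x = (\<Prod>i\<in>UNIV. (x $ i) ^ \<alpha> i)"

text \<open>
  The positive Borel measures on the whole space with all moments finite and support in \<open>K\<close>.
  Measures on a closed set \<open>K\<close> are represented throughout as Borel measures on the whole
  space supported in \<open>K\<close>, so integrals over \<open>K\<close> are written as integrals over the space.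
\<close>

definition moment_measures :: "(real ^ 'n::finite) set \<Rightarrow> (real ^ 'n) measure set" where
  "moment_measures K = {\<sigma>. sets \<sigma> = sets borel \<and>
     (\<forall>\<alpha>. integrable \<sigma> (monomial \<alpha>)) \<and> measure_support \<sigma> \<subseteq> K}"

definition determinate_on :: "(real ^ 'n::finite) set \<Rightarrow> (real ^ 'n) measure \<Rightarrow> bool" where
  "determinate_on K \<sigma> \<longleftrightarrow> \<sigma> \<in> moment_measures K \<and>
     (\<forall>\<sigma>'\<in>moment_measures K.
        (\<forall>\<alpha>. integral\<^sup>L \<sigma>' (monomial \<alpha>) = integral\<^sup>L \<sigma> (monomial \<alpha>)) \<longrightarrow> \<sigma>' = \<sigma>)"

text \<open>Elements of \<open>L\<^sup>2(\<mu>)\<close> are represented by complex-valued functions, not classes.\<close>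

definition L2_functions :: "'a measure \<Rightarrow> ('a \<Rightarrow> complex) set" where
  "L2_functions \<mu> = {f \<in> borel_measurable \<mu>. integrable \<mu> (\<lambda>t. (cmod (f t))\<^sup>2)}"

definition dense_in_L2 :: "('a \<Rightarrow> complex) set \<Rightarrow> 'a measure \<Rightarrow> bool" where
  "dense_in_L2 P \<mu> \<longleftrightarrow> P \<subseteq> L2_functions \<mu> \<and>
     (\<forall>f\<in>L2_functions \<mu>. \<forall>\<epsilon>>0. \<exists>q\<in>P. sqrt (\<integral>t. (cmod (f t - q t))\<^sup>2 \<partial>\<mu>) < \<epsilon>)"

definition complex_polynomials :: "(real ^ 'n::finite \<Rightarrow> complex) set" where
  "complex_polynomials =
     {q. \<exists>A c. finite A \<and> q = (\<lambda>t. \<Sum>\<alpha>\<in>A. c \<alpha> * complex_of_real (monomial \<alpha> t))}"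

definition strictly_determinate_on :: "(real ^ 'n::finite) set \<Rightarrow> (real ^ 'n) measure \<Rightarrow> bool" where
  "strictly_determinate_on T \<mu> \<longleftrightarrow> determinate_on T \<mu> \<and> dense_in_L2 complex_polynomials \<mu>"

definition fibre :: "'a set \<Rightarrow> ('a \<Rightarrow> 'b) \<Rightarrow> 'b \<Rightarrow> 'a set" where
  "fibre X p t = {x \<in> X. p x = t}"

text \<open>
  A disintegration of \<open>\<nu>\<close> with respect to \<open>p : X \<rightarrow> T\<close>, where the image measure is
  \<open>distr \<nu> borel p\<close>.  The integral formula includes the existence of both integrals, since
  the Bochner integral of a non-integrable function is 0 by convention.  The outer
  integrability is taken with respect to the completion, because \<open>\<lambda>\<^sub>t\<close> is arbitrary on null sets,
  where the inner integral need not depend on \<open>t\<close> in a Borel measurable way.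
\<close>

definition disintegration ::
  "(real ^ 'd::finite) set \<Rightarrow> (real ^ 'm::finite) set \<Rightarrow> (real ^ 'd \<Rightarrow> real ^ 'm) \<Rightarrow>
     (real ^ 'd) measure \<Rightarrow> (real ^ 'm \<Rightarrow> (real ^ 'd) measure) \<Rightarrow> bool" where
  "disintegration X T p \<nu> \<Lambda> \<longleftrightarrow>
     (\<forall>t\<in>T. sets (\<Lambda> t) = sets borel \<and> measure_support (\<Lambda> t) \<subseteq> fibre X p t) \<and>
     (AE t in distr \<nu> borel p. emeasure (\<Lambda> t) (fibre X p t) = 1) \<and>
     (\<forall>f :: real ^ 'd \<Rightarrow> real. integrable \<nu> f \<longrightarrow>
        (AE t in distr \<nu> borel p. integrable (\<Lambda> t) f) \<and>
        integrable (completion (distr \<nu> borel p)) (\<lambda>t. integral\<^sup>L (\<Lambda> t) f) \<and>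
        integral\<^sup>L \<nu> f = (\<integral>t. integral\<^sup>L (\<Lambda> t) f \<partial>completion (distr \<nu> borel p)))"

end

theory Submission
  imports Defs
begin

text \<open>
  Let \<open>\<nu>'\<close> be a measure on \<open>X\<close> with the moments of \<open>\<nu>\<close>. A monomial composed with \<open>p\<close> is a
  polynomial, so the images of \<open>\<nu>\<close> and \<open>\<nu>'\<close> under \<open>p\<close> have the same moments on \<open>T\<close>, and determinacy
  of \<open>\<mu>\<close> makes both images equal to \<open>\<mu>\<close>. Now disintegrate \<open>\<nu>'\<close> as well, with fibre measures
  \<open>\<Lambda>'\<close>, and for a fixed \<open>\<alpha>\<close> let \<open>h\<close> be the difference of the \<open>\<alpha>\<close>-th moments of
  \<open>\<Lambda>' t\<close> and \<open>\<Lambda> t\<close>. Integrating the polynomial \<open>monomial \<beta> (p x) * monomial \<alpha> x\<close> against \<open>\<nu>\<close>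
  and \<open>\<nu>'\<close> shows that \<open>h\<close> is orthogonal to every monomial \<open>\<beta>\<close> in \<open>L\<^sup>2(\<mu>)\<close>; it belongs to
  \<open>L\<^sup>2(\<mu>)\<close> because the square of a mean is at most the mean of the square. As polynomials are dense,
  \<open>h\<close> vanishes almost everywhere. There are only countably many \<open>\<alpha>\<close>, so for almost every \<open>t\<close> all
  moments of \<open>\<Lambda>' t\<close> and \<open>\<Lambda> t\<close> agree, determinacy on the fibre gives \<open>\<Lambda>' t = \<Lambda> t\<close>, and integrating
  over \<open>\<mu>\<close> gives \<open>\<nu>' = \<nu>\<close>. The steps are \<open>image_moment_measure\<close>,
  \<open>disintegrations_AE_same_moment\<close> (which rests on \<open>orthogonal_to_polynomials_imp_AE_zero\<close>)
  and \<open>measure_eqI_disintegration\<close>.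

  Most of the work is the existence of the second disintegration, \<open>disintegration_exists\<close>. For a
  random variable with values in \<open>[0, 1]\<close> the conditional distribution is obtained from its
  distribution function: Radon--Nikodym densities of the events \<open>Y \<le> q\<close>, for rational \<open>q\<close>, are
  almost surely monotone in \<open>q\<close>, and their right-continuous regularisation defines a
  Lebesgue--Stieltjes measure for each \<open>t\<close>. A Euclidean space is reduced to this case by a Borel
  map into \<open>[0, 1]\<close> that has a Borel left inverse. That the resulting kernel is carried by the fibres
  of \<open>p\<close> is seen by testing it on the preimages of a countable basis.
\<close>

section \<open>Borel coding of Euclidean points by numbers in the unit interval\<close>

definition quaternary_digit :: "nat \<Rightarrow> real \<Rightarrow> bool" where
  "quaternary_digit n y \<longleftrightarrow> odd \<lfloor>4 ^ Suc n * y\<rfloor>"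

text \<open>
  Bits are stored as the base-4 digits 0 and 1. This keeps the tail of the series below 1, so that
  the floor in \<open>quaternary_digit\<close> really cuts off the tail; and as the base is even, the parity of
  the integer part is the last digit.
\<close>

definition encode_bits :: "(nat \<Rightarrow> bool) \<Rightarrow> real" where
  "encode_bits s = (\<Sum>n. of_bool (s n) / 4 ^ Suc n)"

lemma summable_encode_bits: "summable (\<lambda>n. of_bool (s n) / (4::real) ^ Suc n)"
proof (rule summable_comparison_test)
  show "\<exists>N. \<forall>n\<ge>N. norm (of_bool (s n) / (4::real) ^ Suc n) \<le> (1/4) ^ Suc n"
    by (auto simp: power_one_over divide_simps)
  show "summable (\<lambda>n. (1/4::real) ^ Suc n)"
    by (subst summable_Suc_iff) (simp add: summable_geometric)
qed

lemma encode_bits_bounds: "0 \<le> encode_bits s" "encode_bits s \<le> 1/3"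
proof -
  show "0 \<le> encode_bits s"
    unfolding encode_bits_def by (rule suminf_nonneg[OF summable_encode_bits]) auto
  have s: "(\<lambda>n. (1/4::real) ^ Suc n) sums (1/3)"
    using sums_mult[OF geometric_sums[of "1/4::real"], of "1/4"] by simp
  have "encode_bits s \<le> (\<Sum>n. (1/4) ^ Suc n)"
    unfolding encode_bits_def
    by (rule suminf_le[OF _ summable_encode_bits])
       (use s in \<open>auto simp: power_one_over divide_simps sums_iff\<close>)
  then show "encode_bits s \<le> 1/3"
    using s by (simp add: sums_iff)
qed

lemma quaternary_digit_encode_bits: "quaternary_digit n (encode_bits s) \<longleftrightarrow> s n"
proof -
  \<comment> \<open>\<open>z\<close> collects the digits before position \<open>n\<close>; each of them contributes a multiple of 4.\<close>
  define z :: int where "z = (\<Sum>k<n. of_bool (s k) * 4 ^ (n - k))"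
  have "encode_bits s = (\<Sum>k. of_bool (s (k + Suc n)) / 4 ^ Suc (k + Suc n))
      + (\<Sum>k<Suc n. of_bool (s k) / 4 ^ Suc k)"
    unfolding encode_bits_def
    by (rule suminf_split_initial_segment[OF summable_encode_bits])
  also have "(\<Sum>k. of_bool (s (k + Suc n)) / (4::real) ^ Suc (k + Suc n))
      = (\<Sum>k. of_bool (s (k + Suc n)) / 4 ^ Suc k / 4 ^ Suc n)"
    by (intro suminf_cong) (simp add: power_add field_simps)
  also have "\<dots> = encode_bits (\<lambda>k. s (k + Suc n)) / 4 ^ Suc n"
    unfolding encode_bits_def by (rule suminf_divide[OF summable_encode_bits])
  finally have "4 ^ Suc n * encode_bits s = encode_bits (\<lambda>k. s (k + Suc n))
      + 4 ^ Suc n * (\<Sum>k<Suc n. of_bool (s k) / 4 ^ Suc k)"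
    by (simp add: field_simps)
  also have "4 ^ Suc n * (\<Sum>k<Suc n. of_bool (s k) / (4::real) ^ Suc k)
      = (\<Sum>k<n. of_bool (s k) * 4 ^ (n - k)) + of_bool (s n)"
    by (simp add: sum_distrib_left distrib_left power_diff field_simps)
  finally have "4 ^ Suc n * encode_bits s
      = encode_bits (\<lambda>k. s (k + Suc n)) + of_int (z + of_bool (s n))"
    by (simp add: z_def)
  with encode_bits_bounds[of "\<lambda>k. s (k + Suc n)"]
  have "\<lfloor>4 ^ Suc n * encode_bits s\<rfloor> = z + of_bool (s n)"
    by (intro floor_unique) auto
  moreover have "even z"
    unfolding z_def by (intro dvd_sum) auto
  ultimately show ?thesis
    by (simp add: quaternary_digit_def)
qed

lemma measurable_quaternary_digit [measurable]:
  "Measurable.pred borel (quaternary_digit n)"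
  unfolding quaternary_digit_def by measurable

text \<open>
  A point is coded by the bits that tell, for each coordinate and each rational \<open>q\<close>, whether the
  coordinate exceeds \<open>q\<close>. The coordinate is recovered as the supremum of the \<open>q\<close> whose bit is set.
  The supremum is taken in the extended reals, where it exists also for numbers that code no point.
\<close>

lemma borel_code:
  obtains \<phi> :: "'a::euclidean_space \<Rightarrow> real" and \<psi> :: "real \<Rightarrow> 'a"
  where "\<phi> \<in> borel_measurable borel" "\<psi> \<in> borel_measurable borel"
    "\<And>x. \<psi> (\<phi> x) = x" "\<And>x. 0 \<le> \<phi> x" "\<And>x. \<phi> x \<le> 1"
proof -
  define e :: "'a \<times> real \<Rightarrow> nat" where "e = to_nat_on (Basis \<times> \<rat>)"
  define d :: "nat \<Rightarrow> 'a \<times> real" where "d = from_nat_into (Basis \<times> \<rat>)"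
  have cnt: "countable (Basis \<times> (\<rat> :: real set) :: ('a \<times> real) set)"
    by (intro countable_SIGMA countable_rat countable_finite) auto
  have de: "d (e (b, q)) = (b, q)" if "b \<in> Basis" "q \<in> \<rat>" for b q
    unfolding d_def e_def using cnt that by (intro from_nat_into_to_nat_on) auto
  define \<phi> :: "'a \<Rightarrow> real"
    where "\<phi> x = encode_bits (\<lambda>n. snd (d n) < x \<bullet> fst (d n))" for x
  define c :: "'a \<Rightarrow> real \<Rightarrow> ereal"
    where "c b y = (SUP q\<in>\<rat>. if quaternary_digit (e (b, q)) y then ereal q else -\<infinity>)" for b y
  define \<psi> :: "real \<Rightarrow> 'a"
    where "\<psi> y = (\<Sum>b\<in>Basis. real_of_ereal (c b y) *\<^sub>R b)" for y
  have c: "c b (\<phi> x) = ereal (x \<bullet> b)" if b: "b \<in> Basis" for b x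
  proof -
    have dig: "quaternary_digit (e (b, q)) (\<phi> x) \<longleftrightarrow> q < x \<bullet> b" if "q \<in> \<rat>" for q
      unfolding \<phi>_def quaternary_digit_encode_bits using de[OF b that] by simp
    show ?thesis
      unfolding c_def
    proof (rule SUP_eqI)
      show "(if quaternary_digit (e (b, q)) (\<phi> x) then ereal q else -\<infinity>) \<le> ereal (x \<bullet> b)"
        if "q \<in> \<rat>" for q
        using dig[OF that] by auto
    next
      fix u assume u: "\<And>q. q \<in> \<rat> \<Longrightarrow>
        (if quaternary_digit (e (b, q)) (\<phi> x) then ereal q else -\<infinity>) \<le> u"
      show "ereal (x \<bullet> b) \<le> u"
      proof (rule ccontr)
        assume "\<not> ereal (x \<bullet> b) \<le> u"
        then have "u < ereal (x \<bullet> b)" by simp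
        then obtain r where r: "u < ereal r" "r < x \<bullet> b"
          by (metis ereal_dense2 ereal_less_eq(3) less_ereal.simps(1))
        obtain q where "q \<in> \<rat>" "r < q" "q < x \<bullet> b"
          using Rats_dense_in_real[OF r(2)] by auto
        then have "ereal q \<le> u"
          using u[of q] dig[of q] by simp
        moreover have "ereal r < ereal q"
          using \<open>r < q\<close> by simp
        ultimately show False
          using r(1) by order
      qed
    qed
  qed
  have "\<phi> \<in> borel_measurable borel"
    unfolding \<phi>_def encode_bits_def by measurable
  moreover have [measurable]: "c b \<in> borel_measurable borel" for b
    unfolding c_def by (intro borel_measurable_SUP countable_rat) measurable
  have "\<psi> \<in> borel_measurable borel"
    unfolding \<psi>_def by measurable
  moreover have "\<psi> (\<phi> x) = x" for x
    by (simp add: \<psi>_def c euclidean_representation)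
  moreover have "0 \<le> \<phi> x" "\<phi> x \<le> 1" for x
    using encode_bits_bounds[of "\<lambda>n. snd (d n) < x \<bullet> fst (d n)"] by (simp_all add: \<phi>_def)
  ultimately show thesis
    using that by blast
qed

section \<open>Conditional distributions\<close>

text \<open>
  On the set where \<open>g < f\<close> the positive function \<open>f - g\<close> has integral 0, so this set is null.
\<close>

lemma (in finite_measure) AE_le_if_nn_integrals_le:
  fixes f g :: "'a \<Rightarrow> ennreal"
  assumes [measurable]: "f \<in> borel_measurable M" "g \<in> borel_measurable M"
    and fin: "(\<integral>\<^sup>+x. f x \<partial>M) \<noteq> \<infinity>"
    and le: "\<And>B. B \<in> sets M \<Longrightarrow> (\<integral>\<^sup>+x\<in>B. f x \<partial>M) \<le> (\<integral>\<^sup>+x\<in>B. g x \<partial>M)"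
  shows "AE x in M. f x \<le> g x"
proof -
  define B where "B = {x \<in> space M. g x < f x}"
  have B [measurable]: "B \<in> sets M"
    unfolding B_def by measurable
  have gf: "g x * indicator B x \<le> f x * indicator B x" for x
    by (auto simp: B_def indicator_def)
  have "(\<integral>\<^sup>+x\<in>B. f x \<partial>M) \<le> (\<integral>\<^sup>+x. f x \<partial>M)"
    by (intro nn_integral_mono) (auto simp: indicator_def)
  with le[OF B] fin have fin': "(\<integral>\<^sup>+x\<in>B. g x \<partial>M) \<noteq> \<infinity>" "(\<integral>\<^sup>+x\<in>B. f x \<partial>M) \<noteq> \<infinity>"
    using nn_integral_mono[of M "\<lambda>x. g x * indicator B x" "\<lambda>x. f x * indicator B x"] gf
    by (auto simp: top_unique)
  have "(\<integral>\<^sup>+x. f x * indicator B x - g x * indicator B x \<partial>M)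
      = (\<integral>\<^sup>+x\<in>B. f x \<partial>M) - (\<integral>\<^sup>+x\<in>B. g x \<partial>M)"
    using fin' gf by (intro nn_integral_diff) auto
  also have "\<dots> = 0"
    using le[OF B] by (intro diff_eq_0_ennreal) (use fin' in \<open>auto simp: less_top\<close>)
  finally have "AE x in M. f x * indicator B x - g x * indicator B x = 0"
    by (subst (asm) nn_integral_0_iff_AE) auto
  then show ?thesis
  proof (rule AE_mp, intro AE_I2 impI)
    fix x assume x: "x \<in> space M" "f x * indicator B x - g x * indicator B x = 0"
    show "f x \<le> g x"
    proof (rule ccontr)
      assume "\<not> f x \<le> g x"
      then have "x \<in> B" using x by (auto simp: B_def)
      with x(2) have "f x - g x = 0" by simp
      from ennreal_minus_eq_0[OF this] \<open>\<not> f x \<le> g x\<close> show False by simp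
    qed
  qed
qed

text \<open>
  The function \<open>f\<close> is the conditional probability of \<open>S\<close> given \<open>p = t\<close>: the Radon--Nikodym
  density with respect to the image measure of the image of the part of \<open>M\<close> on \<open>S\<close>.
\<close>

lemma (in finite_measure) conditional_density_exists:
  assumes p [measurable]: "p \<in> M \<rightarrow>\<^sub>M N" and S [measurable]: "S \<in> sets M"
  obtains f :: "'b \<Rightarrow> ennreal" where "f \<in> borel_measurable N"
    "\<And>B. B \<in> sets N \<Longrightarrow>
       (\<integral>\<^sup>+t\<in>B. f t \<partial>distr M N p) = emeasure M {x \<in> space M. p x \<in> B \<and> x \<in> S}"
proof -
  interpret \<mu>: finite_measure "distr M N p"
    using p by (rule finite_measure_distr)
  define N' where "N' = distr (density M (indicator S)) N p"
  have N': "emeasure N' B = emeasure M {x \<in> space M. p x \<in> B \<and> x \<in> S}" if [measurable]: "B \<in> sets N" for B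
  proof -
    have "emeasure N' B = (\<integral>\<^sup>+x. indicator S x * indicator (p -` B \<inter> space M) x \<partial>M)"
      unfolding N'_def by (subst emeasure_distr) (auto simp: emeasure_density)
    also have "\<dots> = (\<integral>\<^sup>+x. indicator {x \<in> space M. p x \<in> B \<and> x \<in> S} x \<partial>M)"
      by (intro nn_integral_cong) (auto simp: indicator_def)
    finally show ?thesis by simp
  qed
  have "absolutely_continuous (distr M N p) N'"
    unfolding absolutely_continuous_def
  proof
    fix B assume B: "B \<in> null_sets (distr M N p)"
    then have [measurable]: "B \<in> sets N" by (auto simp: null_sets_def)
    have "emeasure M {x \<in> space M. p x \<in> B \<and> x \<in> S} \<le> emeasure M (p -` B \<inter> space M)"
      by (intro emeasure_mono) auto
    also have "\<dots> = 0"
      using B by (simp add: null_sets_def emeasure_distr)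
    finally show "B \<in> null_sets N'"
      by (simp add: null_sets_def N') (simp add: N'_def)
  qed
  then obtain f where f: "f \<in> borel_measurable (distr M N p)" "density (distr M N p) f = N'"
    using \<mu>.Radon_Nikodym[of N'] by (auto simp: N'_def)
  show thesis
  proof (rule that)
    show "f \<in> borel_measurable N" using f(1) by simp
    fix B assume B: "B \<in> sets N"
    have "(\<integral>\<^sup>+t\<in>B. f t \<partial>distr M N p) = emeasure (density (distr M N p) f) B"
      using f(1) B by (simp add: emeasure_density)
    then show "(\<integral>\<^sup>+t\<in>B. f t \<partial>distr M N p) = emeasure M {x \<in> space M. p x \<in> B \<and> x \<in> S}"
      using f(2) N'[OF B] by simp
  qed
qed

text \<open>
  Each property of a distribution function holds for almost every \<open>t\<close>, and for rational arguments
  this amounts to countably many conditions. On the exceptional null set the family is replaced by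
  the distribution function of the point mass at 0, so that the properties hold for every \<open>t\<close>.
\<close>

lemma (in finite_measure) conditional_distribution_function_exists:
  fixes Y :: "'a \<Rightarrow> real"
  assumes p [measurable]: "p \<in> M \<rightarrow>\<^sub>M N"
    and Y [measurable]: "Y \<in> borel_measurable M"
    and Y01: "\<And>x. 0 \<le> Y x" "\<And>x. Y x \<le> 1"
  obtains F :: "rat \<Rightarrow> 'b \<Rightarrow> real" where
    "\<And>q. F q \<in> borel_measurable N"
    "\<And>q r t. q \<le> r \<Longrightarrow> F q t \<le> F r t"
    "\<And>q t. q < 0 \<Longrightarrow> F q t = 0" "\<And>q t. 1 \<le> q \<Longrightarrow> F q t = 1"
    "\<And>q B. B \<in> sets N \<Longrightarrow> (\<integral>\<^sup>+t\<in>B. ennreal (F q t) \<partial>distr M N p)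
       = emeasure M {x \<in> space M. p x \<in> B \<and> Y x \<le> of_rat q}"
proof -
  let ?\<mu> = "distr M N p"
  interpret \<mu>: finite_measure ?\<mu>
    using p by (rule finite_measure_distr)
  have "\<exists>f. f \<in> borel_measurable N \<and> (\<forall>B\<in>sets N.
       (\<integral>\<^sup>+t\<in>B. f t \<partial>?\<mu>) = emeasure M {x \<in> space M. p x \<in> B \<and> Y x \<le> of_rat q})" for q
  proof -
    have S: "{x \<in> space M. Y x \<le> of_rat q} \<in> sets M" by measurable
    have *: "{x \<in> space M. p x \<in> B \<and> x \<in> {x \<in> space M. Y x \<le> of_rat q}}
        = {x \<in> space M. p x \<in> B \<and> Y x \<le> of_rat q}" for B
      by auto
    show ?thesis
      by (rule conditional_density_exists[OF p S], unfold *) blast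
  qed
  then have "\<exists>f. \<forall>q. f q \<in> borel_measurable N \<and> (\<forall>B\<in>sets N.
       (\<integral>\<^sup>+t\<in>B. f q t \<partial>?\<mu>) = emeasure M {x \<in> space M. p x \<in> B \<and> Y x \<le> of_rat q})"
    by (intro choice allI)
  then obtain f where f [measurable]: "\<And>q. f q \<in> borel_measurable N"
    and int_f: "\<And>q B. B \<in> sets N \<Longrightarrow>
       (\<integral>\<^sup>+t\<in>B. f q t \<partial>?\<mu>) = emeasure M {x \<in> space M. p x \<in> B \<and> Y x \<le> of_rat q}"
    by blast
  have fin: "(\<integral>\<^sup>+t. f q t \<partial>?\<mu>) \<noteq> \<infinity>" for q
  proof -
    have "(\<integral>\<^sup>+t. f q t \<partial>?\<mu>) = (\<integral>\<^sup>+t\<in>space N. f q t \<partial>?\<mu>)"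
      by (intro nn_integral_cong) auto
    then show ?thesis
      using int_f[OF sets.top, of q] by simp
  qed
  have mono: "AE t in ?\<mu>. f q t \<le> f r t" if "q \<le> r" for q r
  proof (rule \<mu>.AE_le_if_nn_integrals_le)
    fix B assume "B \<in> sets ?\<mu>"
    then have [measurable]: "B \<in> sets N" by simp
    have "(of_rat q :: real) \<le> of_rat r" using that by (simp add: of_rat_less_eq)
    then show "(\<integral>\<^sup>+t\<in>B. f q t \<partial>?\<mu>) \<le> (\<integral>\<^sup>+t\<in>B. f r t \<partial>?\<mu>)"
      by (simp add: int_f) (intro emeasure_mono, auto)
  qed (use fin in auto)
  have zero: "AE t in ?\<mu>. f q t = 0" if "q < 0" for q
  proof -
    have "(of_rat q :: real) < 0" using that by simp
    then have empty: "{x \<in> space M. p x \<in> B \<and> Y x \<le> of_rat q} = {}" for B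
      using Y01(1) by (auto simp: not_le intro: less_le_trans simp del: of_rat_less_0_iff)
    have "AE t in ?\<mu>. f q t \<le> 0"
      by (rule \<mu>.AE_le_if_nn_integrals_le) (use fin int_f in \<open>auto simp: empty\<close>)
    then show ?thesis by simp
  qed
  have one: "AE t in ?\<mu>. f q t = 1" if "1 \<le> q" for q
  proof -
    have "(1 :: real) \<le> of_rat q" using that by simp
    then have Yq: "Y x \<le> of_rat q" for x
      using Y01(2)[of x] by linarith
    have *: "(\<integral>\<^sup>+t\<in>B. f q t \<partial>?\<mu>) = (\<integral>\<^sup>+t\<in>B. 1 \<partial>?\<mu>)" if [measurable]: "B \<in> sets N" for B
    proof -
      have "{x \<in> space M. p x \<in> B \<and> Y x \<le> of_rat q} = p -` B \<inter> space M"
        using Yq by auto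
      then show ?thesis
        by (simp add: int_f emeasure_distr)
    qed
    have "AE t in ?\<mu>. f q t \<le> 1"
      by (rule \<mu>.AE_le_if_nn_integrals_le) (use fin * in auto)
    moreover have "AE t in ?\<mu>. 1 \<le> f q t"
      by (rule \<mu>.AE_le_if_nn_integrals_le) (use * \<mu>.emeasure_finite in \<open>auto simp del: space_distr\<close>)
    ultimately show ?thesis by eventually_elim auto
  qed
  have "AE t in ?\<mu>. (\<forall>q r. q \<le> r \<longrightarrow> f q t \<le> f r t) \<and> (\<forall>q<0. f q t = 0) \<and> (\<forall>q\<ge>1. f q t = 1)"
    using mono zero one by (auto simp: AE_all_countable AE_conj_iff)
  then obtain Z where good: "\<And>t. t \<in> space ?\<mu> - Z \<Longrightarrow>
      (\<forall>q r. q \<le> r \<longrightarrow> f q t \<le> f r t) \<and> (\<forall>q<0. f q t = 0) \<and> (\<forall>q\<ge>1. f q t = 1)"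
    and Z: "Z \<in> null_sets ?\<mu>"
    by (rule AE_E3) blast
  define F :: "rat \<Rightarrow> 'b \<Rightarrow> real" where
    "F q t = (if t \<in> space N - Z then enn2real (f q t) else of_bool (0 \<le> q))" for q t
  have [measurable]: "Z \<in> sets N" using Z by (auto simp: null_sets_def)
  have le1: "f q t \<le> 1" if "t \<in> space N - Z" for q t
  proof -
    have "t \<in> space ?\<mu> - Z" using that by simp
    from good[OF this] have "f q t \<le> f (max q 1) t" "f (max q 1) t = 1"
      by (meson max.cobounded1, meson max.cobounded2)
    then show ?thesis by simp
  qed
  show thesis
  proof (rule that[of F])
    show "F q \<in> borel_measurable N" for q
      unfolding F_def by measurable
    show "F q t \<le> F r t" if "q \<le> r" for q r t
    proof (cases "t \<in> space N - Z")
      case True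
      have "f r t < top" using le1[OF True, of r] by (auto intro: le_less_trans)
      then show ?thesis
        using good[of t] that True by (auto simp: F_def intro!: enn2real_mono)
    qed (use that in \<open>auto simp: F_def\<close>)
    show "F q t = 0" if "q < 0" for q t
      using good[of t] that by (auto simp: F_def)
    show "F q t = 1" if "1 \<le> q" for q t
      using good[of t] that by (auto simp: F_def)
    fix q B assume B [measurable]: "B \<in> sets N"
    have "AE t in ?\<mu>. ennreal (F q t) * indicator B t = f q t * indicator B t"
      using AE_not_in[OF Z] AE_space
    proof eventually_elim
      case (elim t)
      then have t: "t \<in> space N - Z" by simp
      have "f q t < top" using le1[OF t, of q] by (auto intro: le_less_trans)
      then show ?case using t by (simp add: F_def)
    qed
    then have "(\<integral>\<^sup>+t\<in>B. ennreal (F q t) \<partial>?\<mu>) = (\<integral>\<^sup>+t\<in>B. f q t \<partial>?\<mu>)"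
      by (rule nn_integral_cong_AE)
    then show "(\<integral>\<^sup>+t\<in>B. ennreal (F q t) \<partial>?\<mu>)
       = emeasure M {x \<in> space M. p x \<in> B \<and> Y x \<le> of_rat q}"
      by (simp add: int_f)
  qed
qed

text \<open>
  Letting a rational decrease to \<open>y\<close> turns inequalities at rationals into equality at \<open>y\<close>, even
  if one of them holds only between \<open>y\<close> and strictly larger rationals. In this form the lemma
  fits the regularisation of a conditional distribution function given at rationals, where a value
  is an infimum over strictly larger arguments.
\<close>

lemma right_continuous_eqI:
  fixes H K :: "real \<Rightarrow> real"
  assumes "mono H" "mono K"
    and "\<And>y. continuous (at_right y) H" "\<And>y. continuous (at_right y) K"
    and KH: "\<And>y q. y < of_rat q \<Longrightarrow> K y \<le> H (of_rat q)"
    and HK: "\<And>q. H (of_rat q) \<le> K (of_rat q)"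
  shows "H = K"
proof
  fix y
  have step: "\<exists>q. y < of_rat q \<and> G (of_rat q) < G y + e"
    if "mono G" "continuous (at_right y) G" "0 < e" for G :: "real \<Rightarrow> real" and e
  proof -
    have "\<forall>\<epsilon>>0. \<exists>\<delta>>0. G (y + \<delta>) - G y < \<epsilon>"
      using that(2) by (rule continuous_at_right_real_increasing[THEN iffD1, rotated])
        (rule monoD[OF that(1)])
    then obtain d where d: "0 < d" "G (y + d) - G y < e"
      using \<open>0 < e\<close> by blast
    obtain q where "y < of_rat q" "of_rat q < y + d"
      using of_rat_dense[of y "y + d"] d by auto
    with d monoD[OF that(1), of "of_rat q" "y + d"] show ?thesis by (intro exI[of _ q]) auto
  qed
  show "H y = K y"
  proof (rule antisym; rule ccontr)
    assume "\<not> H y \<le> K y"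
    then obtain q where "y < of_rat q" "K (of_rat q) < K y + (H y - K y)"
      using step[of K "H y - K y"] assms by auto
    with HK[of q] monoD[OF \<open>mono H\<close>, of y "of_rat q"] show False by auto
  next
    assume "\<not> K y \<le> H y"
    then obtain q where "y < of_rat q" "H (of_rat q) < H y + (K y - H y)"
      using step[of H "K y - H y"] assms by auto
    with KH[of y q] show False by auto
  qed
qed

text \<open>
  The infimum over the rationals above \<open>y\<close> turns the family \<open>F\<close> into a right-continuous
  distribution function \<open>G t\<close>, and \<open>\<kappa> t\<close> is its Stieltjes measure. The regularisation may change
  the value at a rational \<open>q\<close>, so the integral formula is not inherited from \<open>F\<close> directly. For fixed
  \<open>B\<close> both sides of it are finite measures in \<open>A\<close>, and their distribution functions are compared.
\<close>

lemma (in finite_measure) conditional_kernel_unit_interval: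
  fixes Y :: "'a \<Rightarrow> real"
  assumes p [measurable]: "p \<in> M \<rightarrow>\<^sub>M N"
    and Y [measurable]: "Y \<in> borel_measurable M"
    and Y01: "\<And>x. 0 \<le> Y x" "\<And>x. Y x \<le> 1"
  obtains \<kappa> where "\<kappa> \<in> N \<rightarrow>\<^sub>M prob_algebra borel"
    "\<And>A B. A \<in> sets borel \<Longrightarrow> B \<in> sets N \<Longrightarrow>
       (\<integral>\<^sup>+t\<in>B. emeasure (\<kappa> t) A \<partial>distr M N p) = emeasure M {x \<in> space M. p x \<in> B \<and> Y x \<in> A}"
proof -
  let ?\<mu> = "distr M N p"
  interpret \<mu>: finite_measure ?\<mu>
    using p by (rule finite_measure_distr)
  obtain F :: "rat \<Rightarrow> 'b \<Rightarrow> real" where F [measurable]: "\<And>q. F q \<in> borel_measurable N"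
    and F_mono: "\<And>q r t. q \<le> r \<Longrightarrow> F q t \<le> F r t"
    and F_0: "\<And>q t. q < 0 \<Longrightarrow> F q t = 0" and F_1: "\<And>q t. 1 \<le> q \<Longrightarrow> F q t = 1"
    and int_F: "\<And>q B. B \<in> sets N \<Longrightarrow> (\<integral>\<^sup>+t\<in>B. ennreal (F q t) \<partial>?\<mu>)
       = emeasure M {x \<in> space M. p x \<in> B \<and> Y x \<le> of_rat q}"
    by (rule conditional_distribution_function_exists[OF p Y Y01]) (rule that; assumption)
  have F_nonneg: "0 \<le> F q t" for q t
    using F_mono[of "min q (-1)" q t] F_0[of "min q (-1)" t] by simp
  have F_le1: "F q t \<le> 1" for q t
    using F_mono[of q "max q 1" t] F_1[of "max q 1" t] by simp
  define G where "G t y = (INF q\<in>{q. y < of_rat q}. F q t)" for t and y :: real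
  have ne: "{q. y < of_rat q} \<noteq> {}" for y :: real
    using of_rat_dense[of y "y + 1"] by auto
  have bdd: "bdd_below ((\<lambda>q. F q t) ` Q)" for t Q
    using F_nonneg by (intro bdd_belowI2[of _ 0]) auto
  have G_le: "G t y \<le> F q t" if "y < of_rat q" for t y q
    unfolding G_def using that by (intro cINF_lower bdd) auto
  have le_G: "c \<le> G t y" if "\<And>q. y < of_rat q \<Longrightarrow> c \<le> F q t" for c t y
    unfolding G_def using that by (intro cINF_greatest ne) auto
  have F_le_G: "F q t \<le> G t y" if "of_rat q \<le> y" for t y q
  proof (rule le_G)
    fix r assume "y < of_rat r"
    with that have "(of_rat q :: real) < of_rat r" by linarith
    then show "F q t \<le> F r t" by (intro F_mono) (simp add: of_rat_less)
  qed
  have G_nonneg: "0 \<le> G t y" for t y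
    by (rule le_G) (rule F_nonneg)
  have G_mono: "G t y \<le> G t z" if "y \<le> z" for t y z
    using that by (intro le_G G_le) simp
  have G_right: "continuous (at_right y) (G t)" for t y
  proof (subst continuous_at_right_real_increasing[OF G_mono], assumption, intro allI impI)
    fix e :: real assume "0 < e"
    have "\<exists>q\<in>{q. y < of_rat q}. F q t < G t y + e"
    proof (rule ccontr)
      assume "\<not> ?thesis"
      then have "G t y + e \<le> G t y" by (intro le_G) (meson mem_Collect_eq not_less)
      with \<open>0 < e\<close> show False by simp
    qed
    then obtain q where q: "y < of_rat q" "F q t < G t y + e" by auto
    obtain r where r: "y < of_rat r" "of_rat r < (of_rat q :: real)"
      using of_rat_dense[OF q(1)] by auto
    have "G t (of_rat r) \<le> F q t" using r(2) by (rule G_le)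
    with q r show "\<exists>d>0. G t (y + d) - G t y < e"
      by (intro exI[of _ "of_rat r - y"]) auto
  qed
  have G_neg: "G t y = 0" if "y < 0" for t y
  proof -
    obtain q where q: "y < of_rat q" "of_rat q < (0 :: real)"
      using of_rat_dense[OF \<open>y < 0\<close>] by auto
    have "G t y \<le> F q t" using q(1) by (rule G_le)
    moreover have "F q t = 0" using q(2) by (intro F_0) simp
    ultimately show ?thesis using G_nonneg[of t y] by simp
  qed
  have G_ge1: "G t y = 1" if "1 \<le> y" for t y
  proof (rule antisym)
    show "1 \<le> G t y" using F_le_G[of 1 y t] F_1[of 1 t] that by simp
    obtain q where "y < of_rat q" using ne[of y] by auto
    from G_le[OF this, of t] F_le1[of q t] show "G t y \<le> 1" by simp
  qed
  have bot: "(G t \<longlongrightarrow> 0) at_bot" for t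
    by (intro tendsto_eventually eventually_mono[OF eventually_gt_at_bot[of 0]])
       (auto intro!: G_neg)
  have top: "(G t \<longlongrightarrow> 1) at_top" for t
    by (intro tendsto_eventually eventually_mono[OF eventually_ge_at_top[of 1]])
       (auto intro!: G_ge1)
  have G_meas [measurable]: "(\<lambda>t. G t y) \<in> borel_measurable N" for y
    unfolding G_def by (intro borel_measurable_cINF_real F) auto
  define \<kappa> where "\<kappa> t = interval_measure (G t)" for t
  have \<kappa>_real: "real_distribution (\<kappa> t)" for t
    unfolding \<kappa>_def by (rule real_distribution_interval_measure[OF G_mono G_right bot top])
  have \<kappa>_atMost: "emeasure (\<kappa> t) {..y} = ennreal (G t y)" for t y
    unfolding \<kappa>_def by (rule emeasure_interval_measure_Iic[OF G_mono G_right bot])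
  have \<kappa> [measurable]: "\<kappa> \<in> N \<rightarrow>\<^sub>M prob_algebra borel"
  proof (rule measurable_prob_algebra_generated)
    show "sets borel = sigma_sets (UNIV :: real set) (range atMost)"
      by (subst borel_eq_atMost) simp
    show "Int_stable (range (atMost :: real \<Rightarrow> real set))"
      by (auto simp: Int_stable_def)
    show "prob_space (\<kappa> t)" "sets (\<kappa> t) = sets borel" for t
      using \<kappa>_real[of t] by (auto simp: real_distribution_def real_distribution.events_eq_borel)
    fix A :: "real set" assume "A \<in> range atMost"
    then obtain y where "A = {..y}" by auto
    then show "(\<lambda>t. emeasure (\<kappa> t) A) \<in> borel_measurable N"
      by (simp add: \<kappa>_atMost)
  qed auto
  have \<kappa>_sub: "\<kappa> \<in> N \<rightarrow>\<^sub>M subprob_algebra borel"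
    using \<kappa> by (rule measurable_prob_algebraD)
  show thesis
  proof (rule that[OF \<kappa>])
    fix A :: "real set" and B assume A: "A \<in> sets borel" and B [measurable]: "B \<in> sets N"
    show "(\<integral>\<^sup>+t\<in>B. emeasure (\<kappa> t) A \<partial>?\<mu>) = emeasure M {x \<in> space M. p x \<in> B \<and> Y x \<in> A}"
    proof (cases "space N = {}")
      case True
      then have "B = {}" using sets.sets_into_space[OF B] by simp
      then show ?thesis by simp
    next
      case False
      define M1 where "M1 = distr (density M (indicator {x \<in> space M. p x \<in> B})) borel Y"
      define M2 where "M2 = density ?\<mu> (indicator B) \<bind> \<kappa>"
      have M1: "emeasure M1 A = emeasure M {x \<in> space M. p x \<in> B \<and> Y x \<in> A}"
        if [measurable]: "A \<in> sets borel" for A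
      proof -
        have "emeasure M1 A = (\<integral>\<^sup>+x. indicator {x \<in> space M. p x \<in> B} x * indicator (Y -` A \<inter> space M) x \<partial>M)"
          unfolding M1_def by (subst emeasure_distr) (auto simp: emeasure_density)
        also have "\<dots> = (\<integral>\<^sup>+x. indicator {x \<in> space M. p x \<in> B \<and> Y x \<in> A} x \<partial>M)"
          by (intro nn_integral_cong) (auto simp: indicator_def)
        finally show ?thesis by simp
      qed
      have M2: "emeasure M2 A = (\<integral>\<^sup>+t\<in>B. emeasure (\<kappa> t) A \<partial>?\<mu>)" if "A \<in> sets borel" for A
      proof -
        have "(\<lambda>t. emeasure (\<kappa> t) A) \<in> borel_measurable N"
          using measurable_emeasure_kernel[OF \<kappa>_sub that] .
        moreover have "emeasure M2 A = (\<integral>\<^sup>+t. emeasure (\<kappa> t) A \<partial>density ?\<mu> (indicator B))"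
          unfolding M2_def
          by (rule emeasure_bind[OF _ _ that]) (use False \<kappa>_sub in \<open>auto simp: measurable_density_eq1\<close>)
        ultimately show ?thesis
          by (simp add: nn_integral_density mult.commute)
      qed
      have "sets M1 = sets borel"
        by (simp add: M1_def)
      moreover have "sets M2 = sets borel"
        unfolding M2_def using False by (intro sets_bind sets_kernel[OF \<kappa>_sub]) auto
      ultimately have sets: "sets M1 = sets borel" "sets M2 = sets borel" by auto
      then have space: "space M1 = UNIV" "space M2 = UNIV"
        by (auto dest: sets_eq_imp_space_eq)
      have \<kappa>_le1: "emeasure (\<kappa> t) UNIV \<le> 1" for t
        using \<kappa>_real[of t] unfolding real_distribution_def by (intro prob_space.emeasure_le_1) auto
      have "emeasure M2 UNIV = (\<integral>\<^sup>+t\<in>B. emeasure (\<kappa> t) UNIV \<partial>?\<mu>)"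
        by (rule M2) simp
      also have "\<dots> \<le> (\<integral>\<^sup>+t. 1 \<partial>?\<mu>)"
        by (intro nn_integral_mono) (simp add: indicator_def \<kappa>_le1)
      also have "\<dots> < \<infinity>" using \<mu>.emeasure_finite[of "space ?\<mu>"]
        by (simp add: less_top[symmetric] del: space_distr)
      finally have "finite_measure M2"
        using space by (intro finite_measureI) auto
      then have fb2: "finite_borel_measure M2"
        by (simp add: finite_borel_measure_def finite_borel_measure_axioms_def sets)
      have "finite_measure M1"
        using space M1[of UNIV] by (intro finite_measureI) auto
      then have fb1: "finite_borel_measure M1"
        by (simp add: finite_borel_measure_def finite_borel_measure_axioms_def sets)
      interpret M1: finite_borel_measure M1 by (rule fb1)
      interpret M2: finite_borel_measure M2 by (rule fb2)
      have "cdf M1 = cdf M2"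
      proof (rule right_continuous_eqI)
        show "mono (cdf M1)" "mono (cdf M2)"
          by (auto intro!: monoI M1.cdf_nondecreasing M2.cdf_nondecreasing)
        show "continuous (at_right y) (cdf M1)" "continuous (at_right y) (cdf M2)" for y
          by (rule M1.cdf_is_right_cont M2.cdf_is_right_cont)+
        show "cdf M2 y \<le> cdf M1 (of_rat q)" if "y < of_rat q" for y q
        proof -
          have "emeasure M2 {..y} \<le> emeasure M1 {..of_rat q}"
            using that by (simp add: M1 M2 \<kappa>_atMost int_F[OF B, symmetric])
              (intro nn_integral_mono, auto simp: indicator_def intro!: ennreal_leI G_le)
          then show ?thesis
            by (simp add: cdf_def M1.emeasure_eq_measure M2.emeasure_eq_measure)
        qed
        show "cdf M1 (of_rat q) \<le> cdf M2 (of_rat q)" for q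
        proof -
          have "emeasure M1 {..of_rat q} \<le> emeasure M2 {..of_rat q}"
            by (simp add: M1 M2 \<kappa>_atMost int_F[OF B, symmetric])
              (intro nn_integral_mono, auto simp: indicator_def intro!: ennreal_leI F_le_G)
          then show ?thesis
            by (simp add: cdf_def M1.emeasure_eq_measure M2.emeasure_eq_measure)
        qed
      qed
      then have "M1 = M2"
        by (rule cdf_unique'[OF fb1 fb2])
      then show ?thesis
        using M1[OF A] M2[OF A] by simp
    qed
  qed
qed

text \<open>
  The kernel of the coded variable \<open>\<phi> (X x)\<close> is decoded by pushing it forward along \<open>\<psi>\<close>.
\<close>

lemma (in finite_measure) conditional_kernel_exists:
  fixes X :: "'a \<Rightarrow> 'c::euclidean_space"
  assumes p [measurable]: "p \<in> M \<rightarrow>\<^sub>M N" and X [measurable]: "X \<in> borel_measurable M"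
  obtains \<kappa> where "\<kappa> \<in> N \<rightarrow>\<^sub>M prob_algebra borel"
    "\<And>A B. A \<in> sets borel \<Longrightarrow> B \<in> sets N \<Longrightarrow>
       (\<integral>\<^sup>+t\<in>B. emeasure (\<kappa> t) A \<partial>distr M N p) = emeasure M {x \<in> space M. p x \<in> B \<and> X x \<in> A}"
proof -
  obtain \<phi> :: "'c \<Rightarrow> real" and \<psi> where [measurable]: "\<phi> \<in> borel_measurable borel" "\<psi> \<in> borel_measurable borel"
    and \<psi>\<phi>: "\<And>x. \<psi> (\<phi> x) = x" and \<phi>01: "\<And>x. 0 \<le> \<phi> x" "\<And>x. \<phi> x \<le> 1"
    using borel_code by blast
  obtain \<kappa> where \<kappa>: "\<kappa> \<in> N \<rightarrow>\<^sub>M prob_algebra borel"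
    and int_\<kappa>: "\<And>A B. A \<in> sets borel \<Longrightarrow> B \<in> sets N \<Longrightarrow>
       (\<integral>\<^sup>+t\<in>B. emeasure (\<kappa> t) A \<partial>distr M N p) = emeasure M {x \<in> space M. p x \<in> B \<and> \<phi> (X x) \<in> A}"
    by (rule conditional_kernel_unit_interval[OF p, of "\<lambda>x. \<phi> (X x)"]) (auto simp: \<phi>01)
  show thesis
  proof (rule that)
    show "(\<lambda>t. distr (\<kappa> t) borel \<psi>) \<in> N \<rightarrow>\<^sub>M prob_algebra borel"
      by (rule measurable_compose[OF \<kappa> measurable_distr_prob_space]) measurable
    fix A :: "'c set" and B assume [measurable]: "A \<in> sets borel" and B: "B \<in> sets N"
    have \<psi>A: "\<psi> -` A \<in> sets borel"
      using measurable_sets[of \<psi> borel borel A] by simp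
    have "emeasure (distr (\<kappa> t) borel \<psi>) A = emeasure (\<kappa> t) (\<psi> -` A)" if "t \<in> space N" for t
    proof -
      have s: "sets (\<kappa> t) = sets borel"
        using measurable_space[OF \<kappa> that] by (simp add: space_prob_algebra)
      then show ?thesis
        by (subst emeasure_distr)
           (auto simp: sets_eq_imp_space_eq[OF s] measurable_cong_sets[OF s refl])
    qed
    then have "(\<integral>\<^sup>+t\<in>B. emeasure (distr (\<kappa> t) borel \<psi>) A \<partial>distr M N p)
        = (\<integral>\<^sup>+t\<in>B. emeasure (\<kappa> t) (\<psi> -` A) \<partial>distr M N p)"
      by (intro nn_integral_cong) simp
    then show "(\<integral>\<^sup>+t\<in>B. emeasure (distr (\<kappa> t) borel \<psi>) A \<partial>distr M N p)
        = emeasure M {x \<in> space M. p x \<in> B \<and> X x \<in> A}"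
      using int_\<kappa>[OF \<psi>A B] by (simp add: \<psi>\<phi>)
  qed
qed

section \<open>Existence of disintegrations\<close>

text \<open>
  Fubini's theorem for a kernel and a function of either sign. It follows from
  \<open>nn_integral_bind\<close> by splitting \<open>f\<close> into its positive and negative part; the real-valued inner
  integrals \<open>a\<close> of the two parts represent the extended ones wherever the integral of the
  absolute value is finite.
\<close>

lemma integral_bind_kernel:
  fixes f :: "'b \<Rightarrow> real"
  assumes \<kappa> [measurable]: "\<kappa> \<in> M \<rightarrow>\<^sub>M subprob_algebra L" and ne: "space M \<noteq> {}"
    and f: "integrable (M \<bind> \<kappa>) f"
  shows "AE t in M. integrable (\<kappa> t) f"
    and "integrable M (\<lambda>t. \<integral>x. f x \<partial>\<kappa> t)"
    and "(\<integral>x. f x \<partial>(M \<bind> \<kappa>)) = (\<integral>t. \<integral>x. f x \<partial>\<kappa> t \<partial>M)"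
proof -
  have setsb: "sets (M \<bind> \<kappa>) = sets L"
    using ne by (intro sets_bind sets_kernel[OF \<kappa>]) auto
  have fL [measurable]: "f \<in> borel_measurable L"
    using borel_measurable_integrable[OF f] by (simp add: measurable_cong_sets[OF setsb refl])
  have f\<kappa>: "f \<in> borel_measurable (\<kappa> t)" if "t \<in> space M" for t
    using fL by (simp add: measurable_cong_sets[OF sets_kernel[OF \<kappa> that] refl])
  have inner [measurable]: "(\<lambda>t. \<integral>\<^sup>+x. g x \<partial>\<kappa> t) \<in> borel_measurable M"
    if "g \<in> borel_measurable L" for g
    by (rule measurable_compose[OF \<kappa> nn_integral_measurable_subprob_algebra[OF that]])
  have fin_norm: "(\<integral>\<^sup>+t. \<integral>\<^sup>+x. ennreal \<bar>f x\<bar> \<partial>\<kappa> t \<partial>M) < \<infinity>"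
    using f by (subst nn_integral_bind[OF _ \<kappa>, symmetric]) (auto simp: integrable_iff_bounded)
  have AE_fin: "AE t in M. (\<integral>\<^sup>+x. ennreal \<bar>f x\<bar> \<partial>\<kappa> t) < \<infinity>"
    using nn_integral_PInf_AE[of "\<lambda>t. \<integral>\<^sup>+x. ennreal \<bar>f x\<bar> \<partial>\<kappa> t" M] fin_norm
    by (auto simp: less_top)
  show int: "AE t in M. integrable (\<kappa> t) f"
    using AE_fin AE_space
    by eventually_elim (auto simp: integrable_iff_bounded f\<kappa>)
  define h where "h t = (\<integral>x. f x \<partial>\<kappa> t)" for t
  have h [measurable]: "h \<in> borel_measurable M"
    unfolding h_def by (rule measurable_compose[OF \<kappa> integral_measurable_subprob_algebra[OF fL]])
  have "(\<integral>\<^sup>+t. ennreal (norm (h t)) \<partial>M) \<le> (\<integral>\<^sup>+t. \<integral>\<^sup>+x. ennreal \<bar>f x\<bar> \<partial>\<kappa> t \<partial>M)"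
  proof (rule nn_integral_mono_AE)
    show "AE t in M. ennreal (norm (h t)) \<le> (\<integral>\<^sup>+x. ennreal \<bar>f x\<bar> \<partial>\<kappa> t)"
      using int by eventually_elim
        (unfold h_def real_norm_def[symmetric], rule integral_norm_bound_ennreal)
  qed
  also note fin_norm
  finally show inth: "integrable M (\<lambda>t. \<integral>x. f x \<partial>\<kappa> t)"
    unfolding h_def[symmetric] by (intro integrableI_bounded h)
  define a where "a g t = enn2real (\<integral>\<^sup>+x. ennreal (g x) \<partial>\<kappa> t)" for g :: "'b \<Rightarrow> real" and t
  have a: "integrable M (a g) \<and> (\<integral>t. a g t \<partial>M) = enn2real (\<integral>\<^sup>+x. ennreal (g x) \<partial>(M \<bind> \<kappa>))"
    if [measurable]: "g \<in> borel_measurable L" and gf: "\<And>x. g x \<le> \<bar>f x\<bar>" for g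
  proof -
    have [measurable]: "a g \<in> borel_measurable M"
      unfolding a_def by measurable
    have "AE t in M. ennreal (a g t) = (\<integral>\<^sup>+x. ennreal (g x) \<partial>\<kappa> t)"
      using AE_fin
    proof eventually_elim
      case (elim t)
      have "(\<integral>\<^sup>+x. ennreal (g x) \<partial>\<kappa> t) \<le> (\<integral>\<^sup>+x. ennreal \<bar>f x\<bar> \<partial>\<kappa> t)"
        by (intro nn_integral_mono ennreal_leI gf)
      with elim show ?case by (auto simp: a_def)
    qed
    then have eq: "(\<integral>\<^sup>+t. ennreal (a g t) \<partial>M) = (\<integral>\<^sup>+x. ennreal (g x) \<partial>(M \<bind> \<kappa>))"
      by (subst nn_integral_bind[OF _ \<kappa>]) (auto intro: nn_integral_cong_AE)
    also have "\<dots> \<le> (\<integral>\<^sup>+x. ennreal \<bar>f x\<bar> \<partial>(M \<bind> \<kappa>))"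
      by (intro nn_integral_mono ennreal_leI gf)
    also have "\<dots> < \<infinity>"
      using f by (simp add: integrable_iff_bounded)
    finally have fin: "(\<integral>\<^sup>+t. ennreal (a g t) \<partial>M) < \<infinity>" .
    have nonneg: "0 \<le> a g t" for t by (simp add: a_def)
    have "integrable M (a g)"
      using fin nonneg by (intro integrableI_nonneg) auto
    moreover have "(\<integral>t. a g t \<partial>M) = enn2real (\<integral>\<^sup>+t. ennreal (a g t) \<partial>M)"
      by (rule integral_eq_nn_integral) (auto simp: nonneg)
    ultimately show ?thesis using eq by simp
  qed
  have af: "integrable M (a f)" "(\<integral>t. a f t \<partial>M) = enn2real (\<integral>\<^sup>+x. ennreal (f x) \<partial>(M \<bind> \<kappa>))"
    using a[of f] by auto
  have am: "integrable M (a (\<lambda>x. - f x))"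
      "(\<integral>t. a (\<lambda>x. - f x) t \<partial>M) = enn2real (\<integral>\<^sup>+x. ennreal (- f x) \<partial>(M \<bind> \<kappa>))"
    using a[of "\<lambda>x. - f x"] by auto
  note [measurable] = borel_measurable_integrable[OF af(1)] borel_measurable_integrable[OF am(1)]
  have "AE t in M. h t = a f t - a (\<lambda>x. - f x) t"
    using int by eventually_elim (simp add: h_def a_def real_lebesgue_integral_def)
  then have "(\<integral>t. h t \<partial>M) = (\<integral>t. a f t - a (\<lambda>x. - f x) t \<partial>M)"
    by (intro integral_cong_AE) auto
  also have "\<dots> = (\<integral>t. a f t \<partial>M) - (\<integral>t. a (\<lambda>x. - f x) t \<partial>M)"
    using af am by (intro Bochner_Integration.integral_diff)
  also have "\<dots> = (\<integral>x. f x \<partial>(M \<bind> \<kappa>))"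
    using af am f by (simp add: real_lebesgue_integral_def)
  finally show "(\<integral>x. f x \<partial>(M \<bind> \<kappa>)) = (\<integral>t. \<integral>x. f x \<partial>\<kappa> t \<partial>M)"
    by (simp add: h_def)
qed

text \<open>
  Every point outside the support has a basic open null neighbourhood, and a second countable
  space has only countably many basic open sets.
\<close>

lemma AE_in_closed_superset_of_support:
  fixes M :: "'a::second_countable_topology measure"
  assumes "sets M = sets borel" and supp: "measure_support M \<subseteq> K"
  shows "AE x in M. x \<in> K"
proof -
  obtain \<B> :: "'a set set" where \<B>: "countable \<B>" "topological_basis \<B>"
    using ex_countable_basis by blast
  have null: "\<Union>{V\<in>\<B>. emeasure M V = 0} \<in> null_sets M"
    using \<B> assms(1)
    by (intro null_sets_UN'[where N = id, simplified])
       (auto simp: null_sets_def topological_basis_open intro: countable_subset[of _ \<B>])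
  have "{x \<in> space M. x \<notin> K} \<subseteq> \<Union>{V\<in>\<B>. emeasure M V = 0}"
  proof
    fix x assume "x \<in> {x \<in> space M. x \<notin> K}"
    then have "x \<notin> measure_support M" using supp by auto
    then obtain U where U: "open U" "x \<in> U" "emeasure M U = 0"
      by (auto simp: measure_support_def not_gr_zero)
    obtain V where V: "V \<in> \<B>" "x \<in> V" "V \<subseteq> U"
      using topological_basisE[OF \<B>(2) U(1,2)] by blast
    have "emeasure M V \<le> emeasure M U"
      using V U assms(1) by (intro emeasure_mono) auto
    with U V show "x \<in> \<Union>{V\<in>\<B>. emeasure M V = 0}" by auto
  qed
  with null show ?thesis by (rule AE_I')
qed

lemma measure_support_subset_closed:
  assumes "closed K" and "emeasure M (- K) = 0"
  shows "measure_support M \<subseteq> K"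
  using assms by (force simp: measure_support_def open_Compl)

text \<open>
  The kernel \<open>\<kappa>\<close> of the identity variable given \<open>p\<close> almost surely gives mass 0 to the complement of
  \<open>X\<close>, and to \<open>p -` U\<close> for each basic open set \<open>U\<close> not containing \<open>t\<close>; the latter sets cover the
  points with \<open>p x \<noteq> t\<close>. On the exceptional null set of \<open>t\<close> the zero measure is used, since the support
  condition of a disintegration has to hold for every \<open>t\<close> in \<open>T\<close>.
\<close>

lemma disintegration_exists:
  fixes p :: "real ^ 'd::finite \<Rightarrow> real ^ 'm::finite"
  assumes X: "closed X" and p: "continuous_on UNIV p"
    and fin: "finite_measure \<nu>" and sets: "sets \<nu> = sets borel"
    and supp: "measure_support \<nu> \<subseteq> X"
  obtains \<Lambda> where "disintegration X T p \<nu> \<Lambda>"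
proof -
  interpret finite_measure \<nu> by (rule fin)
  note [measurable_cong] = sets
  have pb [measurable]: "p \<in> borel_measurable borel"
    using p by (rule borel_measurable_continuous_onI)
  have p\<nu> [measurable]: "p \<in> \<nu> \<rightarrow>\<^sub>M borel" by measurable
  have space: "space \<nu> = UNIV"
    using sets_eq_imp_space_eq[OF sets] by simp
  define \<mu> where "\<mu> = distr \<nu> borel p"
  have sp\<mu>: "space \<mu> = UNIV" and sets\<mu> [measurable_cong]: "sets \<mu> = sets borel"
    by (auto simp: \<mu>_def)
  obtain \<kappa> where \<kappa>: "\<kappa> \<in> borel \<rightarrow>\<^sub>M prob_algebra borel"
    and "\<And>A B. A \<in> sets borel \<Longrightarrow> B \<in> sets borel \<Longrightarrow>
       (\<integral>\<^sup>+t\<in>B. emeasure (\<kappa> t) A \<partial>distr \<nu> borel p) = emeasure \<nu> {x \<in> space \<nu>. p x \<in> B \<and> x \<in> A}"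
    by (rule conditional_kernel_exists[OF p\<nu>, of "\<lambda>x. x"]) auto
  then have joint: "(\<integral>\<^sup>+t\<in>B. emeasure (\<kappa> t) A \<partial>\<mu>) = emeasure \<nu> {x. p x \<in> B \<and> x \<in> A}"
    if "A \<in> sets borel" "B \<in> sets borel" for A B
    using that by (simp add: space \<mu>_def)
  have \<kappa>b [measurable]: "\<kappa> \<in> borel \<rightarrow>\<^sub>M subprob_algebra borel"
    using \<kappa> by (rule measurable_prob_algebraD)
  have \<kappa>\<mu>: "\<kappa> \<in> \<mu> \<rightarrow>\<^sub>M subprob_algebra borel" by measurable
  have \<kappa>_prob: "prob_space (\<kappa> t)" and \<kappa>_sets: "sets (\<kappa> t) = sets borel" for t
    using measurable_space[OF \<kappa>, of t] by (auto simp: space_prob_algebra)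
  have \<kappa>_meas [measurable]: "(\<lambda>t. emeasure (\<kappa> t) A) \<in> borel_measurable borel" if "A \<in> sets borel" for A
    using measurable_emeasure_kernel[OF \<kappa>b that] .
  have \<nu>_bind: "\<mu> \<bind> \<kappa> = \<nu>"
  proof (rule measure_eqI)
    show eq: "sets (\<mu> \<bind> \<kappa>) = sets \<nu>"
      using sp\<mu> \<kappa>_sets by (simp add: sets_bind[where N = borel] sets)
    fix A assume "A \<in> sets (\<mu> \<bind> \<kappa>)"
    then have A: "A \<in> sets borel" using eq sets by simp
    have "emeasure (\<mu> \<bind> \<kappa>) A = (\<integral>\<^sup>+t. emeasure (\<kappa> t) A \<partial>\<mu>)"
      using sp\<mu> by (intro emeasure_bind[OF _ \<kappa>\<mu> A]) auto
    then show "emeasure (\<mu> \<bind> \<kappa>) A = emeasure \<nu> A"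
      using joint[OF A, of UNIV] by simp
  qed
  have vanish: "AE t in \<mu>. t \<in> B \<longrightarrow> emeasure (\<kappa> t) A = 0"
    if A: "A \<in> sets borel" and B: "B \<in> sets borel" and 0: "emeasure \<nu> {x. p x \<in> B \<and> x \<in> A} = 0" for A B
  proof -
    have [measurable]: "(\<lambda>t. emeasure (\<kappa> t) A) \<in> borel_measurable \<mu>"
      using \<kappa>_meas[OF A] by measurable
    have [measurable]: "B \<in> sets \<mu>" using B sets\<mu> by simp
    have "AE t in \<mu>. emeasure (\<kappa> t) A * indicator B t = 0"
      using joint[OF A B] 0 by (subst nn_integral_0_iff_AE[symmetric]) auto
    then show ?thesis by eventually_elim (auto simp: indicator_def)
  qed
  have "emeasure \<nu> (- X) = 0"
    using AE_in_closed_superset_of_support[OF sets supp] X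
    by (subst (asm) AE_iff_measurable[of "- X"]) (auto simp: sets space)
  moreover have "{x. p x \<in> UNIV \<and> x \<in> - X} = - X" by auto
  moreover have "- X \<in> sets borel" using X by (intro borel_comp borel_closed)
  ultimately have "AE t in \<mu>. t \<in> UNIV \<longrightarrow> emeasure (\<kappa> t) (- X) = 0"
    by (intro vanish) simp_all
  then have AE_X: "AE t in \<mu>. emeasure (\<kappa> t) (- X) = 0"
    by eventually_elim simp
  obtain \<B> :: "(real ^ 'm) set set" where \<B>: "countable \<B>" "topological_basis \<B>"
    using ex_countable_basis by blast
  have \<B>_borel: "U \<in> sets borel" if "U \<in> \<B>" for U
    using topological_basis_open[OF \<B>(2) that] by simp
  have pU: "p -` U \<in> sets borel" if "U \<in> \<B>" for U
    using measurable_sets[OF pb \<B>_borel[OF that]] by simp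
  have fib_closed: "closed (fibre X p t)" for t
  proof -
    have "fibre X p t = X \<inter> p -` {t}" by (auto simp: fibre_def)
    then show ?thesis
      using X p by (auto intro!: closed_Int closed_vimage simp: continuous_on_eq_continuous_at)
  qed
  have "AE t in \<mu>. \<forall>U\<in>\<B>. t \<in> - U \<longrightarrow> emeasure (\<kappa> t) (p -` U) = 0"
  proof (subst AE_ball_countable[OF \<B>(1)], intro ballI)
    fix U assume U: "U \<in> \<B>"
    have "{x. p x \<in> - U \<and> x \<in> p -` U} = {}" by auto
    then show "AE t in \<mu>. t \<in> - U \<longrightarrow> emeasure (\<kappa> t) (p -` U) = 0"
      using pU[OF U] \<B>_borel[OF U] by (intro vanish) (auto simp only: emeasure_empty borel_comp)
  qed
  with AE_X have "AE t in \<mu>. emeasure (\<kappa> t) (- fibre X p t) = 0"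
  proof eventually_elim
    case (elim t)
    have "AE x in \<kappa> t. x \<notin> - X"
      using elim(1) X by (intro AE_not_in) (auto simp: null_sets_def \<kappa>_sets)
    moreover have "AE x in \<kappa> t. \<forall>U\<in>\<B>. t \<in> - U \<longrightarrow> x \<notin> p -` U"
    proof (subst AE_ball_countable[OF \<B>(1)], intro ballI)
      fix U assume U: "U \<in> \<B>"
      show "AE x in \<kappa> t. t \<in> - U \<longrightarrow> x \<notin> p -` U"
      proof (cases "t \<in> - U")
        case True
        with elim(2) U have "p -` U \<in> null_sets (\<kappa> t)"
          using pU[OF U] by (auto simp: null_sets_def \<kappa>_sets)
        from AE_not_in[OF this] show ?thesis by eventually_elim simp
      qed simp
    qed
    ultimately have "AE x in \<kappa> t. x \<in> fibre X p t"
    proof eventually_elim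
      case (elim x)
      have "p x = t"
      proof (rule ccontr)
        assume "p x \<noteq> t"
        then obtain U where "open U" "p x \<in> U" "t \<notin> U"
          using t1_space[of "p x" t] by auto
        then obtain V where "V \<in> \<B>" "p x \<in> V" "t \<notin> V"
          using topological_basisE[OF \<B>(2), of U "p x"] by blast
        with elim(2) show False by auto
      qed
      with elim(1) show ?case by (simp add: fibre_def)
    qed
    moreover have "- fibre X p t \<in> sets (\<kappa> t)"
      using fib_closed[of t] by (simp add: \<kappa>_sets borel_closed borel_comp)
    moreover have "{x \<in> space (\<kappa> t). \<not> x \<in> fibre X p t} = - fibre X p t"
      using sets_eq_imp_space_eq[OF \<kappa>_sets[of t]] by auto
    ultimately show ?case
      using AE_iff_measurable[of "- fibre X p t" "\<kappa> t" "\<lambda>x. x \<in> fibre X p t"] by simp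
  qed
  then obtain Z where conc: "\<And>t. t \<in> space \<mu> - Z \<Longrightarrow> emeasure (\<kappa> t) (- fibre X p t) = 0"
    and Z: "Z \<in> null_sets \<mu>"
    by (rule AE_E3) blast
  have [measurable]: "Z \<in> sets borel" using Z sets\<mu> by (auto simp: null_sets_def)
  \<comment> \<open>\<open>Z\<close> is a Borel null set, hence modifying \<open>\<kappa>\<close> on it keeps inner integrals Borel measurable.\<close>
  define \<Lambda> where "\<Lambda> t = (if t \<in> Z then null_measure borel else \<kappa> t)" for t
  have AE_\<Lambda>: "AE t in \<mu>. \<Lambda> t = \<kappa> t"
    using AE_not_in[OF Z] by eventually_elim (simp add: \<Lambda>_def)
  have "disintegration X T p \<nu> \<Lambda>"
    unfolding disintegration_def \<mu>_def[symmetric]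
  proof (intro conjI ballI allI impI)
    fix t
    show "sets (\<Lambda> t) = sets borel"
      by (simp add: \<Lambda>_def \<kappa>_sets)
    show "measure_support (\<Lambda> t) \<subseteq> fibre X p t"
      using conc[of t] sp\<mu>
      by (intro measure_support_subset_closed fib_closed) (auto simp: \<Lambda>_def)
  next
    show "AE t in \<mu>. emeasure (\<Lambda> t) (fibre X p t) = 1"
      using AE_not_in[OF Z]
    proof eventually_elim
      case (elim t)
      interpret prob_space "\<kappa> t" by (rule \<kappa>_prob)
      have "fibre X p t \<in> sets borel" using fib_closed by simp
      moreover have "space (\<kappa> t) = UNIV"
        using sets_eq_imp_space_eq[OF \<kappa>_sets[of t]] by simp
      moreover have "emeasure (\<kappa> t) (- fibre X p t) = 0"
        using conc[of t] elim sp\<mu> by auto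
      ultimately have "emeasure (\<kappa> t) (space (\<kappa> t) - (- fibre X p t)) = 1"
        using \<kappa>_sets[of t] emeasure_space_1 by (subst emeasure_compl) auto
      then show ?case
        using elim \<open>space (\<kappa> t) = UNIV\<close> by (simp add: \<Lambda>_def Diff_eq)
    qed
  next
    fix f :: "real ^ 'd \<Rightarrow> real" assume f: "integrable \<nu> f"
    have f': "integrable (\<mu> \<bind> \<kappa>) f" using f by (simp add: \<nu>_bind)
    note kernel = integral_bind_kernel[OF \<kappa>\<mu> _ f', unfolded \<nu>_bind sp\<mu>, simplified]
    show "AE t in \<mu>. integrable (\<Lambda> t) f"
      using kernel(1) AE_\<Lambda> by eventually_elim simp
    have fb: "f \<in> borel_measurable borel"
      using borel_measurable_integrable[OF f] by (simp add: measurable_cong_sets[OF sets refl])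
    have "(\<lambda>t. integral\<^sup>L (\<Lambda> t) f) = (\<lambda>t. if t \<in> Z then 0 else integral\<^sup>L (\<kappa> t) f)"
      by (auto simp: \<Lambda>_def fun_eq_iff integral_null_measure)
    moreover have "(\<lambda>t. if t \<in> Z then 0 else integral\<^sup>L (\<kappa> t) f) \<in> borel_measurable \<mu>"
      using measurable_compose[OF \<kappa>b integral_measurable_subprob_algebra[OF fb]] by measurable
    ultimately have meas: "(\<lambda>t. integral\<^sup>L (\<Lambda> t) f) \<in> borel_measurable \<mu>" by simp
    have eq: "AE t in \<mu>. integral\<^sup>L (\<Lambda> t) f = integral\<^sup>L (\<kappa> t) f"
      using AE_\<Lambda> by eventually_elim simp
    show "integrable (completion \<mu>) (\<lambda>t. integral\<^sup>L (\<Lambda> t) f)"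
      unfolding integrable_completion[OF meas]
      using kernel(2) borel_measurable_integrable[OF kernel(2)] meas eq
      by (subst integrable_cong_AE) auto
    show "integral\<^sup>L \<nu> f = (\<integral>t. integral\<^sup>L (\<Lambda> t) f \<partial>completion \<mu>)"
      unfolding integral_completion[OF meas] kernel(3)
      using borel_measurable_integrable[OF kernel(2)] meas eq
      by (intro integral_cong_AE) auto
  qed
  then show thesis by (rule that)
qed

section \<open>Polynomials and moments\<close>

lemma monomial_mult_component:
  "x $ i * monomial \<alpha> x = monomial (\<alpha>(i := Suc (\<alpha> i))) x"
proof -
  have "monomial (\<alpha>(i := Suc (\<alpha> i))) x
      = x $ i ^ Suc (\<alpha> i) * (\<Prod>j\<in>UNIV - {i}. x $ j ^ (\<alpha>(i := Suc (\<alpha> i))) j)"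
    unfolding monomial_def by (subst prod.remove[of _ i]) auto
  also have "(\<Prod>j\<in>UNIV - {i}. x $ j ^ (\<alpha>(i := Suc (\<alpha> i))) j) = (\<Prod>j\<in>UNIV - {i}. x $ j ^ \<alpha> j)"
    by (intro prod.cong) auto
  also have "x $ i ^ Suc (\<alpha> i) * (\<Prod>j\<in>UNIV - {i}. x $ j ^ \<alpha> j) = x $ i * monomial \<alpha> x"
    unfolding monomial_def by (subst (2) prod.remove[of _ i]) auto
  finally show ?thesis by (rule sym)
qed

lemma real_polynomial_function_monomial_compose:
  assumes "\<And>i. real_polynomial_function (\<lambda>x. p x $ i)"
  shows "real_polynomial_function (\<lambda>x. monomial \<beta> (p x))"
  unfolding monomial_def
  by (intro real_polynomial_function_prod real_polynomial_function_power assms) auto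

lemma real_polynomial_function_monomial: "real_polynomial_function (monomial \<alpha>)"
  by (rule real_polynomial_function_monomial_compose[of "\<lambda>x. x"])
     (intro real_polynomial_function.intros(1) bounded_linear_vec_nth)

lemma borel_measurable_monomial [measurable]: "monomial \<beta> \<in> borel_measurable borel"
  unfolding monomial_def by measurable

text \<open>
  Real polynomial functions are linear combinations of monomials. In this form no coefficients need
  to be tracked through products: the induction proves that multiplication by \<open>f\<close> preserves the
  property of a function that all its products with monomials satisfy \<open>P\<close>, and this
  property of \<open>f\<close> passes to products \<open>f1 * f2\<close> by composition.
\<close>

lemma real_polynomial_function_induct_monomial [consumes 1, case_names monomial add scale]:
  fixes f :: "real ^ 'n::finite \<Rightarrow> real"
  assumes "real_polynomial_function f"
    and P_monomial: "\<And>\<alpha>. P (monomial \<alpha>)"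
    and P_add: "\<And>f g. P f \<Longrightarrow> P g \<Longrightarrow> P (\<lambda>x. f x + g x)"
    and P_scale: "\<And>c f. P f \<Longrightarrow> P (\<lambda>x. c * f x)"
  shows "P f"
proof -
  have P_sum: "P (\<lambda>x. \<Sum>i\<in>I. F i x)" if "finite I" "\<And>i. P (F i)" for I :: "'n set" and F
    using that
  proof (induction I)
    case empty
    show ?case using P_scale[OF P_monomial[of undefined], of 0] by simp
  next
    case (insert i I)
    then show ?case using P_add[of "F i" "\<lambda>x. \<Sum>i\<in>I. F i x"] by simp
  qed
  have "\<forall>g. (\<forall>\<alpha>. P (\<lambda>x. g x * monomial \<alpha> x)) \<longrightarrow> (\<forall>\<alpha>. P (\<lambda>x. f x * g x * monomial \<alpha> x))"
    using assms(1)
  proof induction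
    case (linear f)
    show ?case
    proof (intro allI impI)
      fix g \<alpha> assume g: "\<forall>\<alpha>. P (\<lambda>x. g x * monomial \<alpha> x)"
      have f: "f x = (\<Sum>i\<in>UNIV. f (axis i 1) * x $ i)" for x
      proof -
        interpret bounded_linear f by (rule linear)
        have "f x = f (\<Sum>i\<in>UNIV. x $ i *\<^sub>R axis i 1)"
          using basis_expansion[of x] by (simp add: scalar_mult_eq_scaleR)
        then show ?thesis by (simp add: sum scaleR mult.commute)
      qed
      have eq: "(\<lambda>x. f x * g x * monomial \<alpha> x)
          = (\<lambda>x. \<Sum>i\<in>UNIV. f (axis i 1) * (g x * monomial (\<alpha>(i := Suc (\<alpha> i))) x))"
        by (subst f) (simp add: sum_distrib_right sum_distrib_left monomial_mult_component[symmetric] mult_ac)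
      show "P (\<lambda>x. f x * g x * monomial \<alpha> x)"
        unfolding eq using g by (intro P_sum P_scale) auto
    qed
  next
    case (const c)
    then show ?case by (auto simp: mult.assoc intro!: P_scale)
  next
    case (add f1 f2)
    then show ?case by (auto simp: distrib_right intro!: P_add)
  next
    case (mult f1 f2)
    show ?case
    proof (intro allI impI)
      fix g \<alpha> assume "\<forall>\<alpha>. P (\<lambda>x. g x * monomial \<alpha> x)"
      with mult.IH(2) have "\<forall>\<alpha>. P (\<lambda>x. f2 x * g x * monomial \<alpha> x)" by blast
      with mult.IH(1)[rule_format, of "\<lambda>x. f2 x * g x"]
      show "P (\<lambda>x. f1 x * f2 x * g x * monomial \<alpha> x)" by (simp add: mult.assoc)
    qed
  qed
  then have "P (\<lambda>x. f x * 1 * monomial (\<lambda>_. 0) x)"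
    by (rule allE[of _ "\<lambda>_. 1"]) (simp add: P_monomial)
  then show ?thesis
    by (simp add: monomial_def)
qed

lemma integrable_real_polynomial_function:
  assumes "\<nu> \<in> moment_measures X" "real_polynomial_function f"
  shows "integrable \<nu> f"
  using assms(2,1) by (induction rule: real_polynomial_function_induct_monomial)
    (auto simp: moment_measures_def)

lemma integral_real_polynomial_function_eq:
  assumes \<nu>: "\<nu> \<in> moment_measures X" and \<nu>': "\<nu>' \<in> moment_measures Y"
    and eq: "\<And>\<alpha>. integral\<^sup>L \<nu> (monomial \<alpha>) = integral\<^sup>L \<nu>' (monomial \<alpha>)"
    and f: "real_polynomial_function f"
  shows "integral\<^sup>L \<nu> f = integral\<^sup>L \<nu>' f"
proof -
  have "integrable \<nu> f \<and> integrable \<nu>' f \<and> integral\<^sup>L \<nu> f = integral\<^sup>L \<nu>' f"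
    using f by (induction rule: real_polynomial_function_induct_monomial)
      (use \<nu> \<nu>' eq in \<open>auto simp: moment_measures_def\<close>)
  then show ?thesis by simp
qed

lemma finite_measure_moment_measures:
  assumes "\<nu> \<in> moment_measures X"
  shows "finite_measure \<nu>"
proof -
  have "integrable \<nu> (\<lambda>_. 1 :: real)"
    using integrable_real_polynomial_function[OF assms real_polynomial_function.intros(2)[of 1]] .
  then show ?thesis
    by (auto simp: integrable_iff_bounded less_top[symmetric] intro!: finite_measureI)
qed

section \<open>Fibrewise comparison of moments\<close>

text \<open>
  If \<open>q\<close> is a polynomial and \<open>r\<close> its real part, then \<open>h\<close> is orthogonal to \<open>r\<close>, so by
  Pythagoras the norm of \<open>h\<close> is at most that of \<open>h - r\<close>, which is at most that of \<open>h - q\<close>.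
  By density the last norm can be made arbitrarily small.
\<close>

lemma orthogonal_to_polynomials_imp_AE_zero:
  fixes h :: "real ^ 'n::finite \<Rightarrow> real"
  assumes dense: "dense_in_L2 complex_polynomials \<mu>"
    and h [measurable]: "h \<in> borel_measurable \<mu>" and h2: "integrable \<mu> (\<lambda>t. (h t)\<^sup>2)"
    and orth: "\<And>\<beta>. integrable \<mu> (\<lambda>t. monomial \<beta> t * h t)" "\<And>\<beta>. (\<integral>t. monomial \<beta> t * h t \<partial>\<mu>) = 0"
  shows "AE t in \<mu>. h t = 0"
proof -
  have small: "(\<integral>t. (h t)\<^sup>2 \<partial>\<mu>) < \<epsilon>\<^sup>2" if "0 < \<epsilon>" for \<epsilon> :: real
  proof -
    have "(\<lambda>t. complex_of_real (h t)) \<in> L2_functions \<mu>"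
      using h2 by (simp add: L2_functions_def)
    then obtain q where q: "q \<in> complex_polynomials"
      and close: "sqrt (\<integral>t. (cmod (complex_of_real (h t) - q t))\<^sup>2 \<partial>\<mu>) < \<epsilon>"
      using dense \<open>0 < \<epsilon>\<close> unfolding dense_in_L2_def by meson
    have "q \<in> L2_functions \<mu>"
      using dense q unfolding dense_in_L2_def by blast
    then have [measurable]: "q \<in> borel_measurable \<mu>" and q2: "integrable \<mu> (\<lambda>t. (cmod (q t))\<^sup>2)"
      by (auto simp: L2_functions_def)
    obtain A c where A: "finite A" and q_eq: "q = (\<lambda>t. \<Sum>\<alpha>\<in>A. c \<alpha> * complex_of_real (monomial \<alpha> t))"
      using q unfolding complex_polynomials_def by blast
    define r where "r t = Re (q t)" for t
    have [measurable]: "r \<in> borel_measurable \<mu>" unfolding r_def by measurable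
    have r2: "integrable \<mu> (\<lambda>t. (r t)\<^sup>2)"
      by (rule Bochner_Integration.integrable_bound[OF q2])
         (auto simp: r_def cmod_power2)
    have rh: "r t * h t = (\<Sum>\<alpha>\<in>A. Re (c \<alpha>) * (monomial \<alpha> t * h t))" for t
      by (simp add: r_def q_eq sum_distrib_right mult.assoc)
    have rh_int: "integrable \<mu> (\<lambda>t. r t * h t)"
      unfolding rh using orth(1) by auto
    have rh_0: "(\<integral>t. r t * h t \<partial>\<mu>) = 0"
      unfolding rh using orth by (subst Bochner_Integration.integral_sum) auto
    have diff2: "(h t - r t)\<^sup>2 = (h t)\<^sup>2 - 2 * (r t * h t) + (r t)\<^sup>2" for t
      by (simp add: power2_eq_square algebra_simps)
    have hr_int: "integrable \<mu> (\<lambda>t. (h t - r t)\<^sup>2)"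
      unfolding diff2 using h2 rh_int r2 by auto
    have norm2: "(cmod (complex_of_real (h t) - q t))\<^sup>2 = (h t - r t)\<^sup>2 + (Im (q t))\<^sup>2" for t
      by (simp add: cmod_power2 r_def)
    have im_int: "integrable \<mu> (\<lambda>t. (Im (q t))\<^sup>2)"
      by (rule Bochner_Integration.integrable_bound[OF q2]) (auto simp: cmod_power2)
    have "(\<integral>t. (h t)\<^sup>2 \<partial>\<mu>) \<le> (\<integral>t. (h t)\<^sup>2 \<partial>\<mu>) - 2 * (\<integral>t. r t * h t \<partial>\<mu>) + (\<integral>t. (r t)\<^sup>2 \<partial>\<mu>)"
      by (simp add: rh_0)
    also have "\<dots> = (\<integral>t. (h t - r t)\<^sup>2 \<partial>\<mu>)"
      unfolding diff2 using h2 rh_int r2 by simp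
    also have "\<dots> \<le> (\<integral>t. (cmod (complex_of_real (h t) - q t))\<^sup>2 \<partial>\<mu>)"
      unfolding norm2 using hr_int im_int by (intro integral_mono) auto
    also have "\<dots> < \<epsilon>\<^sup>2"
      using close that by (metis real_sqrt_less_iff real_sqrt_unique less_imp_le)
    finally show ?thesis .
  qed
  have "(\<integral>t. (h t)\<^sup>2 \<partial>\<mu>) = 0"
  proof (rule ccontr)
    assume "(\<integral>t. (h t)\<^sup>2 \<partial>\<mu>) \<noteq> 0"
    moreover have "0 \<le> (\<integral>t. (h t)\<^sup>2 \<partial>\<mu>)" by simp
    ultimately have "0 < (\<integral>t. (h t)\<^sup>2 \<partial>\<mu>)" by linarith
    with small[of "sqrt (\<integral>t. (h t)\<^sup>2 \<partial>\<mu>)"] show False by simp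
  qed
  then have "AE t in \<mu>. (h t)\<^sup>2 = 0"
    using h2 by (subst (asm) integral_nonneg_eq_0_iff_AE) auto
  then show ?thesis by eventually_elim simp
qed

lemma disintegration_formula:
  fixes f :: "real ^ 'd::finite \<Rightarrow> real"
  assumes "disintegration X T p \<nu> \<Lambda>" and "integrable \<nu> f"
  shows "AE t in distr \<nu> borel p. integrable (\<Lambda> t) f"
    and "integrable (completion (distr \<nu> borel p)) (\<lambda>t. integral\<^sup>L (\<Lambda> t) f)"
    and "integral\<^sup>L \<nu> f = (\<integral>t. integral\<^sup>L (\<Lambda> t) f \<partial>completion (distr \<nu> borel p))"
  using assms by (auto simp: disintegration_def)

text \<open>
  Being carried by the fibre follows from the support condition. That the total mass is the mass of
  the fibre needs the fibre to be measurable, which is the case for almost every \<open>t\<close> because a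
  set outside the \<open>\<sigma>\<close>-algebra has \<open>emeasure\<close> 0 by convention, while the fibre has mass 1.
\<close>

lemma disintegration_AE_fibre:
  fixes p :: "real ^ 'd::finite \<Rightarrow> real ^ 'm::finite"
  assumes dis: "disintegration X T p \<nu> \<Lambda>" and T: "AE t in distr \<nu> borel p. t \<in> T"
  shows "AE t in distr \<nu> borel p. prob_space (\<Lambda> t) \<and> (AE x in \<Lambda> t. p x = t)"
proof -
  have "AE t in distr \<nu> borel p. emeasure (\<Lambda> t) (fibre X p t) = 1"
    using dis by (simp add: disintegration_def)
  with T show ?thesis
  proof eventually_elim
    case (elim t)
    have sets: "sets (\<Lambda> t) = sets borel" and "measure_support (\<Lambda> t) \<subseteq> fibre X p t"
      using dis elim(1) by (auto simp: disintegration_def)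
    then have fib: "AE x in \<Lambda> t. x \<in> fibre X p t"
      by (intro AE_in_closed_superset_of_support)
    have "fibre X p t \<in> sets (\<Lambda> t)"
      using elim(2) emeasure_notin_sets[of "fibre X p t" "\<Lambda> t"] by force
    then have "emeasure (\<Lambda> t) (space (\<Lambda> t)) = emeasure (\<Lambda> t) (fibre X p t)"
      using fib by (intro emeasure_eq_AE) auto
    then have "prob_space (\<Lambda> t)"
      using elim(2) by (intro prob_spaceI) simp
    moreover have "AE x in \<Lambda> t. p x = t"
      using fib by eventually_elim (simp add: fibre_def)
    ultimately show ?case ..
  qed
qed

text \<open>
  Applying the disintegration formula to \<open>q (p x) * g x\<close> exhibits \<open>t \<mapsto> \<integral> g d\<Lambda>\<^sub>t\<close> as a
  conditional expectation of \<open>g\<close>, as \<open>q (p x) = q t\<close> on the fibre over \<open>t\<close>. Square integrability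
  comes from the nonnegative variance of \<open>g\<close> under the probability measure \<open>\<Lambda> t\<close>.
\<close>

lemma disintegration_integrals:
  fixes p :: "real ^ 'd::finite \<Rightarrow> real ^ 'm::finite" and g :: "real ^ 'd \<Rightarrow> real"
  assumes dis: "disintegration X T p \<nu> \<Lambda>" and T: "AE t in distr \<nu> borel p. t \<in> T"
    and g: "integrable \<nu> g" and g2: "integrable \<nu> (\<lambda>x. (g x)\<^sup>2)"
  shows disintegration_integrable_square:
      "integrable (completion (distr \<nu> borel p)) (\<lambda>t. (integral\<^sup>L (\<Lambda> t) g)\<^sup>2)"
    and disintegration_integrable_mult: "\<And>q. q \<in> borel_measurable borel \<Longrightarrow> integrable \<nu> (\<lambda>x. q (p x) * g x) \<Longrightarrow>
       integrable (completion (distr \<nu> borel p)) (\<lambda>t. q t * integral\<^sup>L (\<Lambda> t) g)"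
    and disintegration_integral_mult: "\<And>q. q \<in> borel_measurable borel \<Longrightarrow> integrable \<nu> (\<lambda>x. q (p x) * g x) \<Longrightarrow>
       (\<integral>t. q t * integral\<^sup>L (\<Lambda> t) g \<partial>completion (distr \<nu> borel p)) = (\<integral>x. q (p x) * g x \<partial>\<nu>)"
proof -
  let ?\<mu> = "distr \<nu> borel p"
  note formula = disintegration_formula[OF dis]
  note fib = disintegration_AE_fibre[OF dis T]
  note [measurable] = borel_measurable_integrable[OF formula(2)[OF g]]
  have "AE t in ?\<mu>. (integral\<^sup>L (\<Lambda> t) g)\<^sup>2 \<le> integral\<^sup>L (\<Lambda> t) (\<lambda>x. (g x)\<^sup>2)"
    using fib formula(1)[OF g] formula(1)[OF g2]
  proof eventually_elim
    case (elim t)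
    interpret prob_space "\<Lambda> t" using elim by simp
    show ?case
      using variance_positive[of g] variance_eq[OF elim(2,3)] by simp
  qed
  then have "AE t in completion ?\<mu>. norm ((integral\<^sup>L (\<Lambda> t) g)\<^sup>2) \<le> norm (integral\<^sup>L (\<Lambda> t) (\<lambda>x. (g x)\<^sup>2))"
    by (intro AE_completion) (auto elim: eventually_mono)
  then show "integrable (completion ?\<mu>) (\<lambda>t. (integral\<^sup>L (\<Lambda> t) g)\<^sup>2)"
    by (intro Bochner_Integration.integrable_bound[OF formula(2)[OF g2]]) measurable
  fix q :: "real ^ 'm \<Rightarrow> real"
  assume q: "q \<in> borel_measurable borel" and qg: "integrable \<nu> (\<lambda>x. q (p x) * g x)"
  have "AE t in ?\<mu>. integral\<^sup>L (\<Lambda> t) (\<lambda>x. q (p x) * g x) = q t * integral\<^sup>L (\<Lambda> t) g"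
    using fib formula(1)[OF g] formula(1)[OF qg]
  proof eventually_elim
    case (elim t)
    have "integral\<^sup>L (\<Lambda> t) (\<lambda>x. q (p x) * g x) = integral\<^sup>L (\<Lambda> t) (\<lambda>x. q t * g x)"
      using elim by (intro integral_cong_AE) (auto elim: eventually_mono)
    then show ?case by simp
  qed
  then have eq: "AE t in completion ?\<mu>. integral\<^sup>L (\<Lambda> t) (\<lambda>x. q (p x) * g x) = q t * integral\<^sup>L (\<Lambda> t) g"
    by (rule AE_completion)
  have "q \<in> borel_measurable (completion ?\<mu>)"
    using q by (intro measurable_completion) simp
  then have meas: "(\<lambda>t. q t * integral\<^sup>L (\<Lambda> t) g) \<in> borel_measurable (completion ?\<mu>)"
    by measurable
  show "integrable (completion ?\<mu>) (\<lambda>t. q t * integral\<^sup>L (\<Lambda> t) g)"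
    by (rule integrable_cong_AE_imp[OF formula(2)[OF qg] meas eq])
  show "(\<integral>t. q t * integral\<^sup>L (\<Lambda> t) g \<partial>completion ?\<mu>) = (\<integral>x. q (p x) * g x \<partial>\<nu>)"
    unfolding formula(3)[OF qg]
    using eq meas borel_measurable_integrable[OF formula(2)[OF qg]]
    by (intro integral_cong_AE) (auto elim: eventually_mono)
qed

text \<open>
  The difference \<open>d\<close> of the fibrewise moments is orthogonal to all monomials since both
  disintegration formulas evaluate the same moments of \<open>\<nu>\<close> and \<open>\<nu>'\<close>. A disintegration controls its
  inner integrals only on the completion of \<open>\<mu>\<close>, whereas density refers to \<open>\<mu>\<close> itself; hence \<open>d\<close> is
  replaced by an almost everywhere equal function \<open>e\<close> that is measurable with respect to \<open>\<mu>\<close>.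
\<close>

lemma disintegrations_AE_same_moment:
  fixes p :: "real ^ 'd::finite \<Rightarrow> real ^ 'm::finite"
  assumes p: "\<And>i. real_polynomial_function (\<lambda>x. p x $ i)"
    and \<nu>: "\<nu> \<in> moment_measures X" and \<nu>': "\<nu>' \<in> moment_measures X"
    and mom: "\<And>\<alpha>. integral\<^sup>L \<nu>' (monomial \<alpha>) = integral\<^sup>L \<nu> (monomial \<alpha>)"
    and \<mu>: "distr \<nu> borel p = \<mu>" "distr \<nu>' borel p = \<mu>"
    and dense: "dense_in_L2 complex_polynomials \<mu>"
    and T: "AE t in \<mu>. t \<in> T"
    and dis: "disintegration X T p \<nu> \<Lambda>" and dis': "disintegration X T p \<nu>' \<Lambda>'"
  shows "AE t in \<mu>. integral\<^sup>L (\<Lambda>' t) (monomial \<alpha>) = integral\<^sup>L (\<Lambda> t) (monomial \<alpha>)"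
proof -
  let ?g = "monomial \<alpha> :: real ^ 'd \<Rightarrow> real"
  let ?c = "completion \<mu>"
  have sets\<mu>: "sets \<mu> = sets borel" using \<mu>(1) by auto
  have g: "real_polynomial_function ?g" by (rule real_polynomial_function_monomial)
  have g2: "real_polynomial_function (\<lambda>x. (?g x)\<^sup>2)" using g by blast
  have qg: "real_polynomial_function (\<lambda>x. monomial \<beta> (p x) * ?g x)" for \<beta>
    using g real_polynomial_function_monomial_compose[OF p]
    by (intro real_polynomial_function.intros(4))
  note int = integrable_real_polynomial_function[OF \<nu>] and int' = integrable_real_polynomial_function[OF \<nu>']
  have mb: "monomial \<beta> \<in> borel_measurable (borel :: (real ^ 'm) measure)" for \<beta>
    by (rule borel_measurable_monomial)
  define h where "h t = integral\<^sup>L (\<Lambda> t) ?g" for t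
  define h' where "h' t = integral\<^sup>L (\<Lambda>' t) ?g" for t
  have T1: "AE t in distr \<nu> borel p. t \<in> T" "AE t in distr \<nu>' borel p. t \<in> T"
    unfolding \<mu> by (rule T)+
  have hint: "integrable ?c h" "integrable ?c h'"
    using disintegration_formula(2)[OF dis int[OF g]] disintegration_formula(2)[OF dis' int'[OF g]]
    unfolding h_def[abs_def] h'_def[abs_def] \<mu> .
  have h2: "integrable ?c (\<lambda>t. (h t)\<^sup>2)" "integrable ?c (\<lambda>t. (h' t)\<^sup>2)"
    using disintegration_integrable_square[OF dis T1(1) int[OF g] int[OF g2]]
      disintegration_integrable_square[OF dis' T1(2) int'[OF g] int'[OF g2]]
    by (simp_all add: h_def h'_def \<mu>)
  have mh: "integrable ?c (\<lambda>t. monomial \<beta> t * h t)" "integrable ?c (\<lambda>t. monomial \<beta> t * h' t)"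
    "(\<integral>t. monomial \<beta> t * h t \<partial>?c) = (\<integral>t. monomial \<beta> t * h' t \<partial>?c)" for \<beta>
    using disintegration_integrable_mult[OF dis T1(1) int[OF g] int[OF g2] mb int[OF qg]]
      disintegration_integrable_mult[OF dis' T1(2) int'[OF g] int'[OF g2] mb int'[OF qg]]
      disintegration_integral_mult[OF dis T1(1) int[OF g] int[OF g2] mb int[OF qg]]
      disintegration_integral_mult[OF dis' T1(2) int'[OF g] int'[OF g2] mb int'[OF qg]]
      integral_real_polynomial_function_eq[OF \<nu>' \<nu> mom qg]
    by (simp_all add: h_def h'_def \<mu>)
  note [measurable] = borel_measurable_integrable[OF hint(1)] borel_measurable_integrable[OF hint(2)]
  define d where "d t = h t - h' t" for t
  have [measurable]: "d \<in> borel_measurable ?c" unfolding d_def by measurable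
  have sum2: "integrable ?c (\<lambda>t. 2 * (h t)\<^sup>2 + 2 * (h' t)\<^sup>2)"
    using h2 by auto
  have d_le: "(d t)\<^sup>2 \<le> 2 * (h t)\<^sup>2 + 2 * (h' t)\<^sup>2" for t
    using zero_le_power2[of "h t + h' t"] unfolding d_def power2_sum power2_diff by linarith
  have d2: "integrable ?c (\<lambda>t. (d t)\<^sup>2)"
    by (rule Bochner_Integration.integrable_bound[OF sum2]) (measurable, simp add: d_le)
  have md: "integrable ?c (\<lambda>t. monomial \<beta> t * d t)" "(\<integral>t. monomial \<beta> t * d t \<partial>?c) = 0" for \<beta>
    using mh[of \<beta>] by (simp_all add: d_def right_diff_distrib)
  obtain e where e [measurable]: "e \<in> borel_measurable \<mu>" and de: "AE t in \<mu>. d t = e t"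
    using completion_ex_borel_measurable_real[of d \<mu>] by auto
  have dec: "AE t in ?c. d t = e t" using de by (rule AE_completion)
  have ec [measurable]: "e \<in> borel_measurable ?c" using e by (rule measurable_completion)
  have mc [measurable]: "monomial \<beta> \<in> borel_measurable ?c" "monomial \<beta> \<in> borel_measurable \<mu>" for \<beta>
    using mb[of \<beta>] by (auto intro!: measurable_completion simp: measurable_cong_sets[OF sets\<mu> refl])
  have "AE t in \<mu>. e t = 0"
  proof (rule orthogonal_to_polynomials_imp_AE_zero[OF dense e])
    have "integrable ?c (\<lambda>t. (e t)\<^sup>2)"
      by (rule integrable_cong_AE_imp[OF d2]) (use dec in \<open>auto elim: eventually_mono\<close>)
    then show "integrable \<mu> (\<lambda>t. (e t)\<^sup>2)"
      by (subst (asm) integrable_completion) auto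
    fix \<beta>
    have "integrable ?c (\<lambda>t. monomial \<beta> t * e t)"
      by (rule integrable_cong_AE_imp[OF md(1)[of \<beta>]]) (use dec in \<open>auto elim: eventually_mono\<close>)
    then show "integrable \<mu> (\<lambda>t. monomial \<beta> t * e t)"
      by (subst (asm) integrable_completion) auto
    have "(\<integral>t. monomial \<beta> t * e t \<partial>\<mu>) = (\<integral>t. monomial \<beta> t * e t \<partial>?c)"
      by (rule integral_completion[symmetric]) measurable
    also have "\<dots> = (\<integral>t. monomial \<beta> t * d t \<partial>?c)"
      by (rule integral_cong_AE) (use dec in \<open>auto elim: eventually_mono\<close>)
    finally show "(\<integral>t. monomial \<beta> t * e t \<partial>\<mu>) = 0"
      using md(2) by simp
  qed
  with de show ?thesis
    by eventually_elim (simp add: d_def h_def h'_def)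
qed

lemma measure_eqI_disintegration:
  fixes p :: "real ^ 'd::finite \<Rightarrow> real ^ 'm::finite"
  assumes fin: "finite_measure \<nu>" "finite_measure \<nu>'" and sets: "sets \<nu> = sets borel" "sets \<nu>' = sets borel"
    and \<mu>: "distr \<nu> borel p = \<mu>" "distr \<nu>' borel p = \<mu>"
    and dis: "disintegration X T p \<nu> \<Lambda>" and dis': "disintegration X T p \<nu>' \<Lambda>'"
    and eq: "AE t in \<mu>. \<Lambda>' t = \<Lambda> t"
  shows "\<nu>' = \<nu>"
proof (rule measure_eqI)
  show "sets \<nu>' = sets \<nu>" using sets by simp
  fix A assume A: "A \<in> sets \<nu>'"
  interpret \<nu>: finite_measure \<nu> by (rule fin)
  interpret \<nu>': finite_measure \<nu>' by (rule fin)
  define f :: "real ^ 'd \<Rightarrow> real" where "f = indicator A"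
  have f: "integrable \<nu> f" "integrable \<nu>' f"
    using A sets \<nu>.emeasure_finite \<nu>'.emeasure_finite
    by (auto simp: f_def integrable_indicator_iff less_top[symmetric])
  have "integral\<^sup>L \<nu>' f = (\<integral>t. integral\<^sup>L (\<Lambda>' t) f \<partial>completion \<mu>)"
    and m': "integrable (completion \<mu>) (\<lambda>t. integral\<^sup>L (\<Lambda>' t) f)"
    using dis' f(2) by (auto simp: disintegration_def \<mu>)
  moreover have "integral\<^sup>L \<nu> f = (\<integral>t. integral\<^sup>L (\<Lambda> t) f \<partial>completion \<mu>)"
    and m: "integrable (completion \<mu>) (\<lambda>t. integral\<^sup>L (\<Lambda> t) f)"
    using dis f(1) by (auto simp: disintegration_def \<mu>)
  moreover have "AE t in completion \<mu>. integral\<^sup>L (\<Lambda>' t) f = integral\<^sup>L (\<Lambda> t) f"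
    using AE_completion[OF eq] by eventually_elim simp
  then have "(\<integral>t. integral\<^sup>L (\<Lambda>' t) f \<partial>completion \<mu>) = (\<integral>t. integral\<^sup>L (\<Lambda> t) f \<partial>completion \<mu>)"
    using m m' by (intro integral_cong_AE) (auto dest: borel_measurable_integrable)
  ultimately have "integral\<^sup>L \<nu>' f = integral\<^sup>L \<nu> f" by simp
  then have "measure \<nu>' A = measure \<nu> A"
    using A sets sets_eq_imp_space_eq[OF sets(1)] sets_eq_imp_space_eq[OF sets(2)] by (simp add: f_def)
  then show "emeasure \<nu>' A = emeasure \<nu> A"
    by (simp add: \<nu>.emeasure_eq_measure \<nu>'.emeasure_eq_measure)
qed

lemma image_moment_measure:
  fixes p :: "real ^ 'd::finite \<Rightarrow> real ^ 'm::finite"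
  assumes p: "\<And>i. real_polynomial_function (\<lambda>x. p x $ i)" and pm: "p \<in> borel_measurable borel"
    and X: "closed X" and T: "closed T" and pXT: "p ` X \<subseteq> T" and \<nu>: "\<nu> \<in> moment_measures X"
  shows "distr \<nu> borel p \<in> moment_measures T" "AE t in distr \<nu> borel p. t \<in> T"
proof -
  have sets: "sets \<nu> = sets borel" and supp: "measure_support \<nu> \<subseteq> X"
    using \<nu> by (auto simp: moment_measures_def)
  have p\<nu>: "p \<in> \<nu> \<rightarrow>\<^sub>M borel" using pm by (simp add: measurable_cong_sets[OF sets refl])
  have "AE x in \<nu>. p x \<in> T"
    using AE_in_closed_superset_of_support[OF sets supp] by eventually_elim (use pXT in auto)
  then show AE_T: "AE t in distr \<nu> borel p. t \<in> T"
    using T p\<nu> by (subst AE_distr_iff) auto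
  have "emeasure (distr \<nu> borel p) (- T) = 0"
    using AE_T T by (subst (asm) AE_iff_measurable[of "- T"]) (auto intro: borel_closed borel_comp)
  then have "measure_support (distr \<nu> borel p) \<subseteq> T"
    by (rule measure_support_subset_closed[OF T])
  moreover have "integrable (distr \<nu> borel p) (monomial \<beta>)" for \<beta>
    using integrable_real_polynomial_function[OF \<nu> real_polynomial_function_monomial_compose[OF p]] p\<nu>
    by (subst integrable_distr_eq) auto
  ultimately show "distr \<nu> borel p \<in> moment_measures T"
    by (simp add: moment_measures_def)
qed

theorem theorem31:
  fixes X :: "(real ^ 'd::finite) set" and T :: "(real ^ 'm::finite) set"
    and p :: "real ^ 'd \<Rightarrow> real ^ 'm"
    and \<nu> :: "(real ^ 'd) measure" and \<mu> :: "(real ^ 'm) measure"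
    and \<Lambda> :: "real ^ 'm \<Rightarrow> (real ^ 'd) measure"
  assumes "closed X" and "closed T"
    and "\<And>i. real_polynomial_function (\<lambda>x. p x $ i)"
    and "p ` X \<subseteq> T"
    and "\<nu> \<in> moment_measures X"
    and "\<mu> = distr \<nu> borel p"
    and "disintegration X T p \<nu> \<Lambda>"
    and "strictly_determinate_on T \<mu>"
    and "AE t in \<mu>. determinate_on (fibre X p t) (\<Lambda> t)"
  shows "determinate_on X \<nu>"
proof -
  note p = assms(3) and \<nu> = assms(5)
  have det_\<mu>: "determinate_on T \<mu>" and dense: "dense_in_L2 complex_polynomials \<mu>"
    using assms(8) by (auto simp: strictly_determinate_on_def)
  have "continuous_on UNIV (\<lambda>x. \<chi> i. p x $ i)"
    using p by (intro continuous_on_vec_lambda continuous_on_polymonial_function)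
      (simp add: real_polynomial_function_eq)
  then have p_cont: "continuous_on UNIV p"
    by simp
  have pm: "p \<in> borel_measurable borel"
    using p_cont by (rule borel_measurable_continuous_onI)
  have "\<nu>' = \<nu>" if \<nu>': "\<nu>' \<in> moment_measures X"
    and mom: "\<forall>\<alpha>. integral\<^sup>L \<nu>' (monomial \<alpha>) = integral\<^sup>L \<nu> (monomial \<alpha>)" for \<nu>'
  proof -
    have sets: "sets \<nu> = sets borel" "sets \<nu>' = sets borel" and supp': "measure_support \<nu>' \<subseteq> X"
      using \<nu> \<nu>' by (auto simp: moment_measures_def)
    note fin = finite_measure_moment_measures[OF \<nu>] finite_measure_moment_measures[OF \<nu>']
    have "integral\<^sup>L (distr \<nu>' borel p) (monomial \<beta>) = integral\<^sup>L \<mu> (monomial \<beta>)" for \<beta>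
    proof -
      have poly: "real_polynomial_function (\<lambda>x. monomial \<beta> (p x))"
        using p by (rule real_polynomial_function_monomial_compose)
      show ?thesis
        using integral_real_polynomial_function_eq[OF \<nu>' \<nu> mom[rule_format] poly] pm
        by (simp add: assms(6) integral_distr
            measurable_cong_sets[OF sets(1) refl] measurable_cong_sets[OF sets(2) refl])
    qed
    then have \<mu>': "distr \<nu>' borel p = \<mu>"
      using det_\<mu> image_moment_measure(1)[OF p pm assms(1,2,4) \<nu>'] by (auto simp: determinate_on_def)
    obtain \<Lambda>' where dis': "disintegration X T p \<nu>' \<Lambda>'"
      using disintegration_exists[OF assms(1) p_cont fin(2) sets(2) supp'] by blast
    have T: "AE t in \<mu>. t \<in> T"
      unfolding assms(6) by (rule image_moment_measure(2)[OF p pm assms(1,2,4) \<nu>])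
    have same: "AE t in \<mu>. \<forall>\<alpha>. integral\<^sup>L (\<Lambda>' t) (monomial \<alpha>) = integral\<^sup>L (\<Lambda> t) (monomial \<alpha>)"
      unfolding AE_all_countable
      using disintegrations_AE_same_moment[OF p \<nu> \<nu>' mom[rule_format] assms(6)[symmetric] \<mu>' dense T assms(7) dis']
      by blast
    have int': "AE t in \<mu>. \<forall>\<alpha>. integrable (\<Lambda>' t) (monomial \<alpha>)"
      unfolding AE_all_countable
      using disintegration_formula(1)[OF dis', unfolded \<mu>']
        integrable_real_polynomial_function[OF \<nu>' real_polynomial_function_monomial] by blast
    have "AE t in \<mu>. \<Lambda>' t = \<Lambda> t"
      using T same int' assms(9)
    proof eventually_elim
      case (elim t)
      have "\<Lambda>' t \<in> moment_measures (fibre X p t)"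
        using dis' elim(1,3) by (auto simp: disintegration_def moment_measures_def)
      with elim(2,4) show ?case by (simp add: determinate_on_def)
    qed
    then show ?thesis
      by (rule measure_eqI_disintegration[OF fin sets assms(6)[symmetric] \<mu>' assms(7) dis'])
  qed
  with \<nu> show ?thesis
    by (auto simp: determinate_on_def)
qed

end
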